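(* Let $K$ be the finite field of characteristic $p$ and order $q$, let $s=\nu_2([K:\mathbb{F}_p])$ be the exponent of the largest power of $2$ dividing $[K:\mathbb{F}_p]$, and let $d$ be an integer with $\gcd(d,q-1)=1$. If the set $\{W_{K,d}(a): a\in K^\times\}$ has exactly three elements and equals $\{0,A,-A\}$ for some $A$, then $|A|\ge p^{2^{s-1}}\sqrt{q}$.
   Context: $\psi_K(x)=\exp(2\pi i\,\mathrm{Tr}_{K/\mathbb{F}_p}(x)/p)$ is the canonical additive character of $K$, and for $a\in K$ the Weil sum is $W_{K,d}(a)=\sum_{x\in K}\psi_K(x^d+ax)$. *)

theory Defs
  imports "HOL-Analysis.Analysis"
begin

definition fdeg :: "'a::{finite,field} itself \<Rightarrow> nat" where
  "fdeg _ = (THE n. CARD('a) = CHAR('a) ^ n)"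

text \<open>Absolute trace K -> F_p, with values in the prime subfield of K.\<close>
definition abs_trace :: "'a::{finite,field} \<Rightarrow> 'a" where
  "abs_trace x = (\<Sum>i<fdeg TYPE('a). x ^ (CHAR('a) ^ i))"

text \<open>Canonical additive character psi_K(x) = exp(2 pi i Tr(x)/p); the trace value
  in the prime field is identified with the unique k < p with of_nat k = Tr(x).\<close>
definition psi :: "'a::{finite,field} \<Rightarrow> complex" where
  "psi x = exp (2 * pi * \<i> * of_nat (THE k. k < CHAR('a) \<and> of_nat k = abs_trace x)
                 / of_nat CHAR('a))"

definition weil_sum :: "int \<Rightarrow> 'a::{finite,field} \<Rightarrow> complex" where
  "weil_sum d a = (\<Sum>x\<in>(UNIV::'a set). psi (x powi d + a * x))"

end

theory Submission
  imports Defs "HOL-Algebra.Algebraic_Closure_Type" "HOL-Number_Theory.Cong"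
begin

text \<open>
  Write \<open>W\<^sub>S(a)\<close> for the Weil sum over a subfield \<open>S\<close> of \<open>K\<close>. The first and third power moments of
  \<open>W\<^sub>K\<close> give \<open>A\<^sup>2 = q |U|\<close> with \<open>U = {x. (x + 1)\<^sup>d = x\<^sup>d + 1}\<close>, so it suffices that \<open>U\<close> contains the
  subfield of order \<open>p\<close> to the power \<open>2\<^sup>s\<close>. This is shown by climbing the tower of quadratic
  extensions above the prime field.

  On the prime field, \<open>x\<^sup>d = x\<close>: the value \<open>A\<close> is a rational integer, so conjugating the \<open>p\<close>-th roots
  of unity does not change \<open>W\<^sub>K\<close>.

  For the step from \<open>F\<close>, of order \<open>l\<close>, to its quadratic extension \<open>L\<close>, additivity of \<open>x\<^sup>d\<close> on \<open>F\<close> gives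
  \<open>W\<^sub>L(a) = l u(a)\<close> with integers \<open>-1 \<le> u(a) \<le> l\<close>. By the Davenport-Hasse theorem, summing \<open>W\<^sub>K\<close> over
  the fibres of the norm yields the \<open>m\<close>-fold convolution power of \<open>W\<^sub>L\<close> on \<open>L\<^sup>*\<close>, where \<open>m = [K:L]\<close>.
  As \<open>A\<close> is up to sign a power of \<open>p\<close> exceeding \<open>\<surd>q = l\<^sup>m\<close>, the \<open>m\<close>-th power of \<open>u\<close> vanishes modulo \<open>p\<close>; the
  group ring of \<open>L\<^sup>*\<close> modulo \<open>p\<close> is reduced, hence \<open>p\<close> divides every \<open>u(a)\<close> and so \<open>u(a) \<ge> 0\<close>. The
  moments \<open>\<Sum> u = l\<close> and \<open>\<Sum> u\<^sup>2 = l\<^sup>2\<close> now force \<open>u(a) \<in> {0, l}\<close>, and the third moment shows \<open>L \<subseteq> U\<close>.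
\<close>

hide_const (open) Polynomials.degree Polynomials.lead_coeff up_ring.coeff up_ring.monom
  Coset.order module.smult Divisibility.prime Divisibility.irreducible

section \<open>The Davenport-Hasse theorem in an algebraically closed field\<close>

definition root_poly :: "'b::idom multiset \<Rightarrow> 'b poly" where
  "root_poly M = (\<Prod>x\<in>#M. [:-x, 1:])"

lemma root_poly_empty [simp]: "root_poly {#} = 1"
  by (simp add: root_poly_def)

lemma root_poly_add_mset [simp]: "root_poly (add_mset x M) = [:-x, 1:] * root_poly M"
  by (simp add: root_poly_def)

lemma root_poly_nonzero [simp]: "root_poly M \<noteq> 0"
  by (induction M) (auto simp del: mult_pCons_left)

lemma degree_root_poly [simp]: "degree (root_poly M) = size M"
  by (induction M) (auto simp: degree_mult_eq simp del: mult_pCons_left)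

lemma lead_coeff_root_poly [simp]: "coeff (root_poly M) (size M) = 1"
proof -
  have "lead_coeff (root_poly M) = 1"
    by (induction M) (auto simp: lead_coeff_mult simp del: mult_pCons_left degree_root_poly)
  thus ?thesis by simp
qed

lemma proots_root_poly [simp]: "proots (root_poly M) = M"
  by (induction M) (auto simp: proots_mult simp del: mult_pCons_left)

lemma coeff_0_root_poly: "coeff (root_poly M) 0 = (-1) ^ size M * prod_mset M"
  by (induction M) auto

lemma coeff_root_poly_penultimate:
  "M \<noteq> {#} \<Longrightarrow> coeff (root_poly M) (size M - 1) = - sum_mset M"
proof (induction M)
  case (add x M)
  show ?case
  proof (cases "M = {#}")
    case False
    then have "size M \<noteq> 0" by simp
    then obtain n where n: "size M = Suc n" by (cases "size M") auto
    have "coeff (root_poly M) (Suc n) = 1"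
      using lead_coeff_root_poly[of M] n by simp
    then show ?thesis using add.IH[OF False] n by simp
  qed simp
qed simp

lemma root_poly_proots:
  fixes f :: "'b::alg_closed_field poly"
  assumes "lead_coeff f = 1"
  shows "root_poly (proots f) = f"
proof -
  have "f \<noteq> 0" using assms by auto
  then obtain A where "f = smult (lead_coeff f) (\<Prod>x\<in>#A. [:-x, 1:])"
    using alg_closed_imp_factorization by blast
  then have "f = root_poly A" by (simp add: assms root_poly_def)
  then show ?thesis by simp
qed

text \<open>The finite field of order \<open>Q\<close> appears as the set of fixed points of
  \<open>x ^ Q\<close> in an algebraically closed field, so that polynomials over it can be replaced
  by multisets of roots. The characters are constrained only on these fixed points.\<close>

locale davenport_hasse =
  fixes Q :: nat and \<psi> \<kappa> :: "'b::alg_closed_field \<Rightarrow> complex"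
  assumes Q: "Q > 1"
    and frob_add: "\<And>x y :: 'b. (x + y) ^ Q = x ^ Q + y ^ Q"
    and psi_add: "\<And>x y. x ^ Q = x \<Longrightarrow> y ^ Q = y \<Longrightarrow> \<psi> (x + y) = \<psi> x * \<psi> y"
    and psi_nontrivial: "\<exists>c. c ^ Q = c \<and> \<psi> c \<noteq> 1"
    and psi_0: "\<psi> 0 = 1"
    and kappa_mult: "\<And>x y. x ^ Q = x \<Longrightarrow> y ^ Q = y \<Longrightarrow> \<kappa> (x * y) = \<kappa> x * \<kappa> y"
    and kappa_1: "\<kappa> 1 = 1"
begin

section \<open>Frobenius and the multisets of roots stable under it\<close>

definition frob :: "'b \<Rightarrow> 'b" where "frob x = x ^ Q"

lemma frob_0 [simp]: "frob 0 = 0" and frob_1 [simp]: "frob 1 = 1"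
  using Q by (auto simp: frob_def)

lemma frob_plus: "frob (x + y) = frob x + frob y"
  and frob_times: "frob (x * y) = frob x * frob y"
  by (simp_all add: frob_def frob_add power_mult_distrib)

lemma frob_minus: "frob (- x) = - frob x"
  using frob_plus[of x "- x"] by (simp add: eq_neg_iff_add_eq_0 add.commute)

lemma frob_diff: "frob (x - y) = frob x - frob y"
  using frob_plus[of x "- y"] by (simp add: frob_minus)

lemma inj_frob: "inj frob"
proof (rule injI)
  fix x y assume "frob x = frob y"
  then have "(x - y) ^ Q = 0" using frob_diff[of x y] by (simp add: frob_def)
  then show "x = y" by simp
qed

lemma inj_frob_pow: "inj (frob ^^ r)"
  by (rule inj_fn[OF inj_frob])

lemma frob_pow: "(frob ^^ r) x = x ^ (Q ^ r)"
  by (induction r) (simp_all add: frob_def power_mult mult.commute flip: power_mult)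

lemma frob_sum_mset: "frob (\<Sum>\<^sub># M) = (\<Sum>\<^sub># (image_mset frob M))"
  by (induction M) (auto simp: frob_plus)

lemma frob_prod_mset: "frob (\<Prod>\<^sub># M) = (\<Prod>\<^sub># (image_mset frob M))"
  by (induction M) (auto simp: frob_times)

text \<open>In the application this is the extension of degree \<open>r\<close> of the base
  field.\<close>

definition per :: "nat \<Rightarrow> 'b set" where "per r = {x. (frob ^^ r) x = x}"

lemma finite_per: "r > 0 \<Longrightarrow> finite (per r)"
proof -
  assume "r > 0"
  then have "Q ^ r > 1" using Q by (metis one_less_power)
  define f :: "'b poly" where "f = monom 1 (Q ^ r) - monom 1 1"
  have "coeff f (Q ^ r) = 1" using \<open>Q ^ r > 1\<close> by (simp add: f_def)
  then have "f \<noteq> 0" by auto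
  then have "finite {x. poly f x = 0}" by (rule poly_roots_finite)
  moreover have "per r = {x. poly f x = 0}"
    by (auto simp: per_def f_def poly_monom frob_pow)
  ultimately show ?thesis by simp
qed

text \<open>By \<open>inv_mset_iff_coeff\<close> these are the root multisets of the monic
  polynomials of degree \<open>k\<close> over the base field.\<close>

definition inv_msets :: "nat \<Rightarrow> 'b multiset set" where
  "inv_msets k = {M. size M = k \<and> image_mset frob M = M}"

lemma frob_coeff_root_poly:
  "frob (coeff (root_poly M) i) = coeff (root_poly (image_mset frob M)) i"
proof (induction M arbitrary: i)
  case empty
  show ?case by (cases i) auto
next
  case (add x M)
  show ?case using add
    by (cases i) (auto simp: frob_plus frob_times frob_minus frob_diff)
qed

lemma root_poly_inj: "root_poly M = root_poly N \<Longrightarrow> M = N"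
  by (metis proots_root_poly)

text \<open>Applying Frobenius to the roots applies it to the coefficients, and a root multiset and
  its polynomial determine each other.\<close>

lemma inv_mset_iff_coeff:
  "image_mset frob M = M \<longleftrightarrow> (\<forall>i. frob (coeff (root_poly M) i) = coeff (root_poly M) i)"
  by (metis frob_coeff_root_poly poly_eqI root_poly_inj)

lemma finite_inv_msets: "finite (inv_msets k)"
proof (rule finite_imageD)
  \<comment> \<open>The list of the \<open>k + 1\<close> coefficients encodes the multiset; its
    entries lie in the finite set \<open>per 1\<close>.\<close>
  let ?g = "\<lambda>M. map (coeff (root_poly M)) [0..<Suc k]"
  have "?g ` inv_msets k \<subseteq> {xs. set xs \<subseteq> per 1 \<and> length xs = Suc k}"
    by (auto simp: inv_msets_def inv_mset_iff_coeff per_def)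
  then show "finite (?g ` inv_msets k)"
    by (rule finite_subset) (rule finite_lists_length_eq, rule finite_per, simp)
  show "inj_on ?g (inv_msets k)"
  proof (rule inj_onI)
    fix M N assume M: "M \<in> inv_msets k" and N: "N \<in> inv_msets k" and eq: "?g M = ?g N"
    have "coeff (root_poly M) i = coeff (root_poly N) i" for i
    proof (cases "i \<le> k")
      case True
      then have "i \<in> set [0..<Suc k]" by auto
      then show ?thesis using eq by (metis map_eq_conv)
    next
      case False
      then show ?thesis using M N by (simp add: coeff_eq_0 inv_msets_def)
    qed
    then show "M = N" by (intro root_poly_inj poly_eqI)
  qed
qed

text \<open>Sum and product of the roots are, up to sign, the second and the last coefficient. On
  stable multisets this gives a multiplicative function of monic polynomials over the base
  field.\<close>

definition wt :: "'b multiset \<Rightarrow> complex" where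
  "wt M = \<psi> (\<Sum>\<^sub># M) * \<kappa> (\<Prod>\<^sub># M)"

lemma wt_empty [simp]: "wt {#} = 1"
  by (simp add: wt_def psi_0 kappa_1)

lemma wt_union:
  assumes "image_mset frob M = M" "image_mset frob N = N"
  shows "wt (M + N) = wt M * wt N"
proof -
  have "frob (\<Sum>\<^sub># M) = \<Sum>\<^sub># M" "frob (\<Sum>\<^sub># N) = \<Sum>\<^sub># N"
    "frob (\<Prod>\<^sub># M) = \<Prod>\<^sub># M" "frob (\<Prod>\<^sub># N) = \<Prod>\<^sub># N"
    by (simp_all add: frob_sum_mset frob_prod_mset assms)
  then show ?thesis by (simp add: wt_def frob_def psi_add kappa_mult)
qed

text \<open>The coefficient of \<open>T ^ k\<close> in the L-series that sums the multiplicative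
  weight over all monic polynomials over the base field.\<close>

definition elem :: "nat \<Rightarrow> complex" where "elem k = (\<Sum>M\<in>inv_msets k. wt M)"

lemma elem_0: "elem 0 = 1"
proof -
  have "inv_msets 0 = {{#}}" by (auto simp: inv_msets_def)
  then show ?thesis by (simp add: elem_def)
qed

lemma elem_1: "elem 1 = (\<Sum>x | x ^ Q = x. \<psi> x * \<kappa> x)"
proof -
  have "inv_msets 1 = (\<lambda>x. {#x#}) ` {x. x ^ Q = x}"
    by (auto simp: inv_msets_def frob_def dest!: size_1_singleton_mset[unfolded One_nat_def])
  then show ?thesis by (simp add: elem_def sum.reindex inj_on_def wt_def)
qed

text \<open>
  Changing the coefficient of degree \<open>k - 1\<close> translates the sum of the roots and, for \<open>k \<ge> 2\<close>,
  preserves their product; summing the nontrivial character \<open>\<psi>\<close> over these translates gives \<open>0\<close>.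
\<close>

definition shift_mset :: "nat \<Rightarrow> 'b \<Rightarrow> 'b multiset \<Rightarrow> 'b multiset" where
  "shift_mset k c M = proots (root_poly M - monom c (k - 1))"

lemma root_poly_shift_mset:
  assumes "M \<in> inv_msets k" "k \<ge> 1"
  shows "root_poly (shift_mset k c M) = root_poly M - monom c (k - 1)"
    and "size (shift_mset k c M) = k"
proof -
  let ?f = "root_poly M - monom c (k - 1)"
  have size: "size M = k" using assms by (simp add: inv_msets_def)
  have deg: "degree (monom c (k - 1)) < degree (root_poly M)"
    using assms(2) size degree_monom_le[of c "k - 1"] by simp
  have degf: "degree ?f = k"
    using degree_add_eq_left[of "- monom c (k - 1)" "root_poly M"] deg size by simp
  have "coeff ?f k = 1"
    using assms(2) size lead_coeff_root_poly[of M] by simp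
  then show eq: "root_poly (shift_mset k c M) = ?f"
    unfolding shift_mset_def using degf by (intro root_poly_proots) simp
  show "size (shift_mset k c M) = k"
    using degf degree_root_poly[of "shift_mset k c M"] by (simp add: eq)
qed

lemma shift_mset_inv_msets:
  assumes "M \<in> inv_msets k" "k \<ge> 1" "frob c = c"
  shows "shift_mset k c M \<in> inv_msets k"
  using assms root_poly_shift_mset[OF assms(1,2), of c]
  by (auto simp: inv_msets_def inv_mset_iff_coeff frob_diff)

lemma shift_mset_shift_mset:
  assumes "M \<in> inv_msets k" "k \<ge> 1" "frob c = c"
  shows "shift_mset k (- c) (shift_mset k c M) = M"
  by (rule root_poly_inj)
    (simp add: root_poly_shift_mset[OF shift_mset_inv_msets[OF assms] assms(2)]
      root_poly_shift_mset[OF assms(1,2)] flip: minus_monom)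

lemma wt_shift_mset:
  assumes "M \<in> inv_msets k" "k \<ge> 2" "frob c = c"
  shows "wt (shift_mset k c M) = \<psi> c * wt M"
proof -
  have k: "k \<ge> 1" and size: "size M = k" using assms by (auto simp: inv_msets_def)
  note eq = root_poly_shift_mset(1)[OF assms(1) k, of c]
  note sz = root_poly_shift_mset(2)[OF assms(1) k, of c]
  have ne: "M \<noteq> {#}" "shift_mset k c M \<noteq> {#}" using size sz assms(2) by auto
  have "- \<Sum>\<^sub># (shift_mset k c M) = - \<Sum>\<^sub># M - c"
    using coeff_root_poly_penultimate[OF ne(1)] coeff_root_poly_penultimate[OF ne(2)]
    by (simp add: eq sz size)
  then have s: "\<Sum>\<^sub># (shift_mset k c M) = \<Sum>\<^sub># M + c"
    by (simp add: minus_equation_iff algebra_simps)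
  have "(-1) ^ k * \<Prod>\<^sub># (shift_mset k c M) = (-1) ^ k * \<Prod>\<^sub># M"
    using coeff_0_root_poly[of M] coeff_0_root_poly[of "shift_mset k c M"] assms(2)
    by (simp add: eq sz size)
  then have p: "\<Prod>\<^sub># (shift_mset k c M) = \<Prod>\<^sub># M" by simp
  have "frob (\<Sum>\<^sub># M) = \<Sum>\<^sub># M"
    using assms(1) by (simp add: frob_sum_mset inv_msets_def)
  then show ?thesis using assms(3) psi_add by (simp add: wt_def s p frob_def)
qed

text \<open>Consequently the L-series is just \<open>1 + elem 1 * T\<close>, where
  \<open>elem 1\<close> is the Gauss sum of the base field.\<close>

lemma elem_eq_0:
  assumes "k \<ge> 2" shows "elem k = 0"
proof -
  obtain c where c: "frob c = c" "\<psi> c \<noteq> 1" using psi_nontrivial by (auto simp: frob_def)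
  have c': "frob (- c) = - c" using c by (simp add: frob_minus)
  have k: "k \<ge> 1" using assms by simp
  have "elem k = (\<Sum>M\<in>inv_msets k. wt (shift_mset k c M))"
    unfolding elem_def
    by (rule sum.reindex_bij_witness[of _ "shift_mset k c" "shift_mset k (- c)"])
      (use shift_mset_shift_mset[OF _ k c(1)] shift_mset_shift_mset[OF _ k c']
        shift_mset_inv_msets[OF _ k c(1)] shift_mset_inv_msets[OF _ k c'] in auto)
  also have "\<dots> = \<psi> c * elem k"
    by (simp add: elem_def sum_distrib_left wt_shift_mset[OF _ assms c(1)])
  finally show ?thesis using c(2) by simp
qed

text \<open>The first \<open>r\<close> conjugates of \<open>x\<close>, repeated if the period of
  \<open>x\<close> is shorter. For \<open>x\<close> in \<open>per r\<close> this is the root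
  multiset of the characteristic polynomial of \<open>x\<close>; its sum is the trace and its
  product the norm.\<close>

definition traj :: "nat \<Rightarrow> 'b \<Rightarrow> 'b multiset" where
  "traj r x = image_mset (\<lambda>i. (frob ^^ i) x) (mset [0..<r])"

lemma size_traj [simp]: "size (traj r x) = r"
  by (simp add: traj_def)

lemma traj_Suc: "traj (Suc r) x = add_mset ((frob ^^ r) x) (traj r x)"
  by (simp add: traj_def)

lemma image_frob_traj: "image_mset frob (traj r x) = traj r (frob x)"
  by (simp add: traj_def image_mset.compositionality o_def funpow_swap1)

lemma traj_Suc': "traj (Suc r) x = add_mset x (traj r (frob x))"
  by (induction r) (simp_all add: traj_Suc funpow_swap1, simp add: traj_def)

lemma traj_inv: "x \<in> per r \<Longrightarrow> image_mset frob (traj r x) = traj r x"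
  using traj_Suc[of r x] traj_Suc'[of r x] by (simp add: image_frob_traj per_def)

lemma traj_add: "traj (r + s) x = traj r x + traj s ((frob ^^ r) x)"
proof (induction s)
  case 0 show ?case by (simp add: traj_def)
next
  case (Suc s)
  then show ?case by (simp add: traj_Suc funpow_add add.commute[of r s])
qed

lemma traj_mult: "x \<in> per s \<Longrightarrow> traj (j * s) x = repeat_mset j (traj s x)"
proof (induction j)
  case (Suc j)
  have "(frob ^^ s) x = x" using Suc.prems by (simp add: per_def)
  then show ?case using Suc by (simp add: traj_add)
qed (simp add: traj_def)

text \<open>If \<open>s\<close> is the exact period of \<open>x\<close>, only multiples
  \<open>r = j * s\<close> qualify. The trajectory is then \<open>j\<close> copies of the orbit, and
  all orbit points have the same multiplicity in \<open>M\<close>, so \<open>j\<close> runs from 1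
  to \<open>count M x\<close>.\<close>

lemma card_traj_subset:
  assumes M: "image_mset frob M = M" and x: "x \<in># M"
  shows "card {r \<in> {1..size M}. x \<in> per r \<and> traj r x \<subseteq># M} = count M x"
proof -
  have cnt: "count M (frob y) = count M y" for y
  proof -
    have "count (image_mset frob M) (frob y) = count M y" for M
      by (induction M) (auto simp: inj_eq[OF inj_frob])
    then show ?thesis by (metis M)
  qed
  have cnt_pow: "count M ((frob ^^ i) y) = count M y" for i y
    by (induction i) (auto simp: cnt)
  \<comment> \<open>The orbit stays inside the finite multiset \<open>M\<close>, so some iterate
    repeats; injectivity of Frobenius turns the repetition into a period of \<open>x\<close>
    itself.\<close>
  have "(\<lambda>i. (frob ^^ i) x) ` UNIV \<subseteq> set_mset M"
    using x cnt_pow[of _ x] by (auto simp flip: count_greater_zero_iff)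
  then have "finite (range (\<lambda>i. (frob ^^ i) x))" by (rule finite_subset) simp
  then have "\<not> inj (\<lambda>i. (frob ^^ i) x)" using finite_imageD by blast
  then obtain i j where "i < j" "(frob ^^ i) x = (frob ^^ j) x"
    by (metis (mono_tags, lifting) injI linorder_neqE_nat)
  then have "(frob ^^ i) x = (frob ^^ i) ((frob ^^ (j - i)) x)"
    by (metis add_diff_inverse_nat comp_apply funpow_add less_imp_not_less)
  then have "(frob ^^ (j - i)) x = x" using inj_frob_pow by (metis injD)
  then have ex: "\<exists>s>0. (frob ^^ s) x = x" using \<open>i < j\<close> by (intro exI[of _ "j - i"]) auto
  define s where "s = (LEAST s. s > 0 \<and> (frob ^^ s) x = x)"
  have s: "s > 0" "(frob ^^ s) x = x"
    using LeastI_ex[OF ex] by (auto simp: s_def)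
  have least: "s \<le> t" if "t > 0" "(frob ^^ t) x = x" for t
    unfolding s_def using that by (intro Least_le) auto
  have per_iff: "x \<in> per r \<longleftrightarrow> s dvd r" for r
  proof -
    have "(frob ^^ r) x = (frob ^^ (r mod s)) x"
      by (simp add: funpow_mod_eq[OF s(2)])
    moreover have "(frob ^^ (r mod s)) x = x \<longleftrightarrow> r mod s = 0"
      using least[of "r mod s"] s(1) by (metis funpow_0 gr0I linorder_not_less mod_less_divisor)
    ultimately show ?thesis by (simp add: per_def dvd_eq_mod_eq_0)
  qed
  have inj: "inj_on (\<lambda>i. (frob ^^ i) x) {..<s}"
  proof (rule linorder_inj_onI)
    fix i j assume ij: "i < j" "i \<in> {..<s}" "j \<in> {..<s}"
    show "(frob ^^ i) x \<noteq> (frob ^^ j) x"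
    proof
      assume "(frob ^^ i) x = (frob ^^ j) x"
      then have "(frob ^^ i) x = (frob ^^ i) ((frob ^^ (j - i)) x)"
        using ij(1) by (metis add_diff_inverse_nat comp_apply funpow_add less_imp_not_less)
      then have "(frob ^^ (j - i)) x = x" using inj_frob_pow by (metis injD)
      then show False using least[of "j - i"] ij by auto
    qed
  qed auto
  have traj_s: "traj s x = mset_set ((\<lambda>i. (frob ^^ i) x) ` {..<s})"
    using inj by (simp add: traj_def image_mset_mset_set atLeast0LessThan)
  have sub_iff: "traj (j * s) x \<subseteq># M \<longleftrightarrow> j \<le> count M x" for j
  proof -
    have "traj (j * s) x = repeat_mset j (traj s x)"
      using s by (intro traj_mult) (simp add: per_def)
    moreover have "repeat_mset j (traj s x) \<subseteq># M \<longleftrightarrow> j \<le> count M x"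
    proof
      assume "repeat_mset j (traj s x) \<subseteq># M"
      then have "j * count (traj s x) x \<le> count M x" by (metis count_repeat_mset mset_subset_eq_count)
      moreover have "x \<in> (\<lambda>i. (frob ^^ i) x) ` {..<s}" using s(1) by (intro image_eqI[of _ _ 0]) auto
      ultimately show "j \<le> count M x" by (simp add: traj_s)
    next
      assume j: "j \<le> count M x"
      show "repeat_mset j (traj s x) \<subseteq># M"
      proof (rule mset_subset_eqI)
        fix y
        show "count (repeat_mset j (traj s x)) y \<le> count M y"
          using j by (cases "y \<in> (\<lambda>i. (frob ^^ i) x) ` {..<s}") (auto simp: traj_s cnt_pow)
      qed
    qed
    ultimately show ?thesis by simp
  qed
  have "{r \<in> {1..size M}. x \<in> per r \<and> traj r x \<subseteq># M} = (\<lambda>j. j * s) ` {1..count M x}"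
  proof (intro equalityI subsetI)
    fix r assume r: "r \<in> {r \<in> {1..size M}. x \<in> per r \<and> traj r x \<subseteq># M}"
    then obtain j where j: "r = j * s" by (auto simp: per_iff elim: dvdE)
    then show "r \<in> (\<lambda>j. j * s) ` {1..count M x}"
      using r sub_iff[of j] by (intro image_eqI[of _ _ j]) (auto simp: Suc_le_eq)
  next
    fix r assume "r \<in> (\<lambda>j. j * s) ` {1..count M x}"
    then obtain j where j: "r = j * s" "1 \<le> j" "j \<le> count M x"
      by (elim imageE) (simp only: atLeastAtMost_iff)
    then have sub: "traj r x \<subseteq># M" by (simp add: sub_iff)
    \<comment> \<open>The trajectory has size \<open>r\<close>, so the bound on \<open>r\<close>
      comes with the inclusion.\<close>
    then have "r \<le> size M" using size_mset_mono by fastforce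
    then show "r \<in> {r \<in> {1..size M}. x \<in> per r \<and> traj r x \<subseteq># M}"
      using j s(1) sub by (auto simp: per_iff)
  qed
  also have "card \<dots> = card {1..count M x}"
    using s(1) by (intro card_image) (auto simp: inj_on_def)
  finally show ?thesis by simp
qed

section \<open>Power sums and Newton's identities\<close>

definition psum :: "nat \<Rightarrow> complex" where "psum r = (\<Sum>x\<in>per r. wt (traj r x))"

text \<open>This is the logarithmic derivative of the L-series, obtained by double counting:
  \<open>k * wt M\<close> is the weight of \<open>M\<close> summed over its \<open>k\<close>
  elements, and each multiplicity is the number of trajectories of that element contained in
  \<open>M\<close>.\<close>

lemma newton: "of_nat k * elem k = (\<Sum>r\<in>{1..k}. psum r * elem (k - r))"
proof -
  have count: "(\<Sum>r\<in>{1..k}. \<Sum>x\<in>per r. if traj r x \<subseteq># M then wt M else 0) = of_nat k * wt M"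
    if M: "M \<in> inv_msets k" for M
  proof -
    have inv: "image_mset frob M = M" and size: "size M = k" using M by (auto simp: inv_msets_def)
    have in_M: "x \<in># M" if "r \<in> {1..k}" "traj r x \<subseteq># M" for r x
    proof -
      have "x \<in># traj r x" using that(1) by (cases r) (auto simp: traj_Suc')
      then show ?thesis using that(2) mset_subset_eqD by metis
    qed
    \<comment> \<open>A trajectory of positive length contains its starting point, so
      \<open>x\<close> may range over \<open>M\<close> instead of \<open>per r\<close>; this range
      no longer depends on \<open>r\<close> and the sums can be exchanged.\<close>
    have "(\<Sum>r\<in>{1..k}. \<Sum>x\<in>per r. if traj r x \<subseteq># M then wt M else 0)
      = (\<Sum>r\<in>{1..k}. \<Sum>x\<in>set_mset M. if x \<in> per r \<and> traj r x \<subseteq># M then wt M else 0)"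
    proof (rule sum.cong[OF refl])
      fix r assume r: "r \<in> {1..k}"
      have "(\<Sum>x\<in>per r. if traj r x \<subseteq># M then wt M else 0)
        = (\<Sum>x\<in>{x \<in> per r. traj r x \<subseteq># M}. wt M)"
        using finite_per[of r] r by (subst sum.inter_filter) auto
      also have "{x \<in> per r. traj r x \<subseteq># M} = {x \<in> set_mset M. x \<in> per r \<and> traj r x \<subseteq># M}"
        using in_M[OF r] by auto
      also have "(\<Sum>x\<in>\<dots>. wt M) = (\<Sum>x\<in>set_mset M. if x \<in> per r \<and> traj r x \<subseteq># M then wt M else 0)"
        by (subst sum.inter_filter) auto
      finally show "(\<Sum>x\<in>per r. if traj r x \<subseteq># M then wt M else 0)
        = (\<Sum>x\<in>set_mset M. if x \<in> per r \<and> traj r x \<subseteq># M then wt M else 0)" .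
    qed
    also have "\<dots> = (\<Sum>x\<in>set_mset M. \<Sum>r\<in>{1..k}. if x \<in> per r \<and> traj r x \<subseteq># M then wt M else 0)"
      by (rule sum.swap)
    also have "\<dots> = (\<Sum>x\<in>set_mset M. of_nat (count M x) * wt M)"
    proof (rule sum.cong[OF refl])
      fix x assume x: "x \<in># M"
      show "(\<Sum>r\<in>{1..k}. if x \<in> per r \<and> traj r x \<subseteq># M then wt M else 0) = of_nat (count M x) * wt M"
        using card_traj_subset[OF inv x] by (simp add: size flip: sum.inter_filter)
    qed
    also have "\<dots> = of_nat (size M) * wt M"
      by (simp add: size_multiset_overloaded_eq flip: sum_distrib_right)
    finally show ?thesis by (simp add: size)
  qed
  \<comment> \<open>Removing a stable trajectory of length \<open>r\<close> from a stable
    \<open>M\<close> leaves an arbitrary stable multiset of size \<open>k - r\<close>, and the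
    weight is multiplicative.\<close>
  have shift: "(\<Sum>M\<in>inv_msets k. if traj r x \<subseteq># M then wt M else 0) = wt (traj r x) * elem (k - r)"
    if r: "r \<in> {1..k}" and x: "x \<in> per r" for r x
  proof -
    have inv: "image_mset frob (traj r x) = traj r x" by (rule traj_inv[OF x])
    have "(\<Sum>M\<in>inv_msets k. if traj r x \<subseteq># M then wt M else 0)
      = (\<Sum>M\<in>{M \<in> inv_msets k. traj r x \<subseteq># M}. wt M)"
      using finite_inv_msets by (subst sum.inter_filter) auto
    also have "\<dots> = (\<Sum>N\<in>inv_msets (k - r). wt (traj r x + N))"
    proof (rule sum.reindex_bij_witness[of _ "\<lambda>N. traj r x + N" "\<lambda>M. M - traj r x"])
      fix M assume M: "M \<in> {M \<in> inv_msets k. traj r x \<subseteq># M}"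
      then obtain N where N: "M = traj r x + N" by (auto simp: mset_subset_eq_exists_conv)
      have "traj r x + image_mset frob N = traj r x + N"
        using M by (simp add: N inv_msets_def inv)
      then show "M - traj r x \<in> inv_msets (k - r)"
        using M r by (auto simp: inv_msets_def N)
      show "traj r x + (M - traj r x) = M" "wt (traj r x + (M - traj r x)) = wt M"
        by (simp_all add: N)
    qed (use r inv in \<open>auto simp: inv_msets_def\<close>)
    also have "\<dots> = wt (traj r x) * elem (k - r)"
      by (simp add: elem_def sum_distrib_left inv_msets_def wt_union[OF inv])
    finally show ?thesis .
  qed
  have "of_nat k * elem k
      = (\<Sum>M\<in>inv_msets k. \<Sum>r\<in>{1..k}. \<Sum>x\<in>per r. if traj r x \<subseteq># M then wt M else 0)"
    unfolding elem_def sum_distrib_left by (intro sum.cong refl count[symmetric])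
  also have "\<dots> = (\<Sum>r\<in>{1..k}. \<Sum>M\<in>inv_msets k. \<Sum>x\<in>per r. if traj r x \<subseteq># M then wt M else 0)"
    by (rule sum.swap)
  also have "\<dots> = (\<Sum>r\<in>{1..k}. \<Sum>x\<in>per r. \<Sum>M\<in>inv_msets k. if traj r x \<subseteq># M then wt M else 0)"
    by (intro sum.cong[OF refl] sum.swap)
  also have "\<dots> = (\<Sum>r\<in>{1..k}. psum r * elem (k - r))"
    unfolding psum_def sum_distrib_right by (intro sum.cong refl shift)
  finally show ?thesis .
qed

lemma psum_Suc: "psum (Suc r) = (-1) ^ r * elem 1 ^ Suc r"
proof (induction r)
  case 0
  show ?case using newton[of 1] by (simp add: elem_0)
next
  case (Suc r)
  \<comment> \<open>Only the last two terms survive, where the index of \<open>elem\<close> is 0 or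
    1; this gives the recursion \<open>psum (k + 1) = - elem 1 * psum k\<close>.\<close>
  have "{1..Suc (Suc r)} = insert (Suc (Suc r)) (insert (Suc r) {1..r})" by auto
  then have "0 = psum (Suc (Suc r)) + psum (Suc r) * elem 1
      + (\<Sum>i\<in>{1..r}. psum i * elem (Suc (Suc r) - i))"
    using newton[of "Suc (Suc r)"] by (simp add: elem_0 elem_eq_0 add.assoc)
  also have "(\<Sum>i\<in>{1..r}. psum i * elem (Suc (Suc r) - i)) = 0"
    by (intro sum.neutral ballI) (auto simp: elem_eq_0)
  finally show ?case using Suc by (simp add: eq_neg_iff_add_eq_0[symmetric] add_eq_0_iff)
qed

text \<open>The left side is \<open>psum m\<close>, the Gauss sum of the extension of degree
  \<open>m\<close> for the lifted characters, and \<open>elem 1\<close> is the Gauss sum of the base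
  field.\<close>

theorem davenport_hasse:
  assumes "m > 0"
  shows "(\<Sum>x | x ^ (Q ^ m) = x. \<psi> (\<Sum>i<m. x ^ (Q ^ i)) * \<kappa> (\<Prod>i<m. x ^ (Q ^ i)))
    = (-1) ^ (m - 1) * (\<Sum>x | x ^ Q = x. \<psi> x * \<kappa> x) ^ m"
proof -
  have "wt (traj m x) = \<psi> (\<Sum>i<m. x ^ (Q ^ i)) * \<kappa> (\<Prod>i<m. x ^ (Q ^ i))" for x
    by (simp add: wt_def traj_def frob_pow sum_unfold_sum_mset prod_unfold_prod_mset atLeast0LessThan)
  then have "psum m = (\<Sum>x | x ^ (Q ^ m) = x. \<psi> (\<Sum>i<m. x ^ (Q ^ i)) * \<kappa> (\<Prod>i<m. x ^ (Q ^ i)))"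
    by (simp add: psum_def per_def frob_pow)
  then show ?thesis using psum_Suc[of "m - 1"] assms elem_1 by simp
qed

end

section \<open>Finite fields and their additive characters\<close>

definition fixed_field :: "nat \<Rightarrow> 'b::field set" where
  "fixed_field f = {x. x ^ (CHAR('b) ^ f) = x}"

definition prime_field :: "'b::field set" where
  "prime_field = {x. x ^ CHAR('b) = x}"

text \<open>Traces and subfields are given by formulas valid in any field, because they are needed
  both in the finite field and in its algebraic closure.\<close>

definition ff_trace :: "nat \<Rightarrow> 'b::field \<Rightarrow> 'b" where
  "ff_trace f x = (\<Sum>i<f. x ^ (CHAR('b) ^ i))"

definition prime_char :: "'b::field \<Rightarrow> complex" where
  "prime_char x = exp (2 * pi * \<i> * of_nat (THE k. k < CHAR('b) \<and> of_nat k = x) / of_nat CHAR('b))"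

definition trace_char :: "nat \<Rightarrow> 'b::field \<Rightarrow> complex" where
  "trace_char f x = prime_char (ff_trace f x)"

context
  fixes p :: nat
  assumes p_def: "p = CHAR('b::field)" and prime_p: "prime p"
begin

lemma prime_CHAR: "prime CHAR('b)"
  using prime_p by (simp add: p_def)

lemma of_nat_eq_iff_cong: "(of_nat k :: 'b) = of_nat l \<longleftrightarrow> k mod p = l mod p"
proof (induction k l rule: linorder_wlog)
  case (le k l)
  show ?case
  proof (cases "k = l")
    case False
    then have "(of_nat k :: 'b) = of_nat l \<longleftrightarrow> p dvd l - k"
      using of_nat_eq_iff_char_dvd[of k l] le by (simp add: p_def)
    then show ?thesis using le mod_eq_dvd_iff_nat[of k l p] by auto
  qed simp
qed auto

text \<open>The polynomial \<open>X ^ p - X\<close> has at most \<open>p\<close> roots, and the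
  \<open>p\<close> residues are roots by Fermat's little theorem.\<close>

lemma prime_field_eq: "prime_field = (of_nat ` {..<p} :: 'b set)"
proof -
  have p1: "p > 1" using prime_p prime_gt_1_nat by blast
  have inj: "inj_on (of_nat :: nat \<Rightarrow> 'b) {..<p}"
    by (auto simp: inj_on_def of_nat_eq_iff_cong)
  define g :: "'b poly" where "g = monom 1 p - monom 1 1"
  have "coeff g p = 1" using p1 by (simp add: g_def)
  then have g: "g \<noteq> 0" by auto
  have roots: "prime_field = {x. poly g x = 0}"
    by (auto simp: prime_field_def g_def poly_monom p_def)
  have "degree g \<le> p" unfolding g_def by (rule degree_diff_le) (use p1 in \<open>auto intro: order.trans[OF degree_monom_le]\<close>)
  then have "card (prime_field :: 'b set) \<le> p"
    unfolding roots using card_poly_roots_bound[OF g] by linarith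
  moreover have sub: "(of_nat ` {..<p} :: 'b set) \<subseteq> prime_field"
  proof -
    have "of_nat k ^ p = (of_nat k :: 'b)" for k
    proof (induction k)
      case 0 then show ?case using p1 by simp
    next
      case (Suc k)
      then show ?case using freshmans_dream[OF prime_CHAR p_def, of 1 "of_nat k"] by simp
    qed
    then show ?thesis by (auto simp: prime_field_def p_def)
  qed
  moreover have "finite (prime_field :: 'b set)" unfolding roots using g by (rule poly_roots_finite)
  ultimately show ?thesis
    using card_image[OF inj] by (metis card_lessThan card_seteq)
qed

text \<open>The representative need not be reduced modulo \<open>p\<close>, since a multiple of
  \<open>p\<close> changes the angle by full turns. Additivity of the character is then
  immediate.\<close>

lemma prime_char_of_nat: "prime_char (of_nat k :: 'b) = cis (2 * pi * real k / real p)"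
proof -
  have p0: "p > 0" using prime_p prime_gt_0_nat by blast
  have "(THE j. j < CHAR('b) \<and> of_nat j = (of_nat k :: 'b)) = k mod p"
    by (rule the_equality) (use p0 in \<open>auto simp: of_nat_eq_iff_cong simp flip: p_def\<close>)
  then have "prime_char (of_nat k :: 'b) = cis (2 * pi * real (k mod p) / real p)"
    by (simp add: prime_char_def cis_conv_exp mult_ac p_def)
  also have "2 * pi * real k / real p = 2 * pi * real (k mod p) / real p + 2 * pi * real (k div p)"
  proof -
    have "real k = real (k div p) * real p + real (k mod p)"
      by (metis div_mult_mod_eq of_nat_add of_nat_mult)
    then show ?thesis using p0 by (simp add: field_simps)
  qed
  then have "cis (2 * pi * real (k mod p) / real p) = cis (2 * pi * real k / real p)"
    by (simp flip: cis_mult)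
  finally show ?thesis .
qed

lemma prime_char_add:
  assumes "x \<in> prime_field" "y \<in> (prime_field :: 'b set)"
  shows "prime_char (x + y) = prime_char x * prime_char y"
proof -
  obtain k l where kl: "x = of_nat k" "y = of_nat l" using assms unfolding prime_field_eq by auto
  show ?thesis
    using prime_char_of_nat[of "k + l"]
    by (simp add: kl prime_char_of_nat cis_mult add_divide_distrib ring_distribs)
qed

lemma prime_char_eq_1_iff:
  assumes "x \<in> (prime_field :: 'b set)"
  shows "prime_char x = 1 \<longleftrightarrow> x = 0"
proof -
  obtain k where k: "x = of_nat k" "k < p" using assms unfolding prime_field_eq by auto
  show ?thesis
  proof
    assume "prime_char x = 1"
    then have "cos (2 * pi * real k / real p) = 1"
      by (simp add: k prime_char_of_nat complex_eq_iff)
    then obtain i :: int where "2 * pi * real k / real p = of_int i * 2 * pi"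
      using cos_one_2pi_int by blast
    then have "real k = of_int i * real p" using k(2) by (simp add: field_simps)
    then have "int k = i * int p" by (metis of_int_eq_iff of_int_mult of_int_of_nat_eq)
    then have "p dvd k" by (metis dvd_triv_right int_dvd_int_iff)
    then show "x = 0" using k by (auto dest: dvd_imp_le)
  next
    assume "x = 0"
    then show "prime_char x = 1" using prime_char_of_nat[of 0] by simp
  qed
qed

lemma frob_pow_add: "(x + y :: 'b) ^ (p ^ i) = x ^ (p ^ i) + y ^ (p ^ i)"
  using freshmans_dream'[OF prime_CHAR] by (simp add: p_def)

lemma frob_pow_sum: "(\<Sum>a\<in>A. g a :: 'b) ^ (p ^ i) = (\<Sum>a\<in>A. g a ^ (p ^ i))"
  using freshmans_dream_sum'[OF prime_CHAR refl] by (simp add: p_def)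

lemma frob_pow_minus: "(- x :: 'b) ^ (p ^ i) = - (x ^ (p ^ i))"
proof -
  have "p ^ i \<noteq> 0" using prime_p by (simp add: prime_gt_0_nat)
  then have "(x + - x) ^ (p ^ i) = 0" by simp
  then show ?thesis by (simp only: frob_pow_add add_eq_0_iff2) (simp add: eq_neg_iff_add_eq_0 add.commute)
qed

lemma ff_trace_add: "ff_trace f (x + y :: 'b) = ff_trace f x + ff_trace f y"
  by (simp add: ff_trace_def sum.distrib frob_pow_add flip: p_def)

text \<open>The \<open>p\<close>-th power shifts the summands by one place, and the term leaving at
  the top equals the one missing at the bottom.\<close>

lemma ff_trace_frob:
  assumes "x \<in> (fixed_field f :: 'b set)"
  shows "ff_trace f x ^ p = ff_trace f x"
proof -
  have "ff_trace f x ^ p = (\<Sum>i<f. x ^ (p ^ Suc i))"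
    using frob_pow_sum[of "\<lambda>i. x ^ (p ^ i)" "{..<f}" 1]
    by (simp add: ff_trace_def mult.commute flip: p_def power_mult)
  also have "\<dots> + x = (\<Sum>i<Suc f. x ^ (p ^ i))"
    by (subst sum.lessThan_Suc_shift) (simp add: add.commute)
  also have "\<dots> = ff_trace f x + x"
    using assms by (simp add: ff_trace_def fixed_field_def flip: p_def)
  finally show ?thesis by simp
qed

lemma ff_trace_in_prime_field:
  "x \<in> (fixed_field f :: 'b set) \<Longrightarrow> ff_trace f x \<in> prime_field"
  using ff_trace_frob by (simp add: prime_field_def flip: p_def)

lemma trace_char_add:
  "x \<in> fixed_field f \<Longrightarrow> y \<in> (fixed_field f :: 'b set) \<Longrightarrow>
    trace_char f (x + y) = trace_char f x * trace_char f y"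
  by (simp add: trace_char_def ff_trace_add prime_char_add ff_trace_in_prime_field)

lemma trace_char_0: "trace_char f (0 :: 'b) = 1"
proof -
  have "ff_trace f (0 :: 'b) = 0"
    using prime_p by (simp add: ff_trace_def prime_gt_0_nat power_0_left flip: p_def)
  then show ?thesis using prime_char_of_nat[of 0] by (simp add: trace_char_def)
qed

text \<open>The trace is a nonzero polynomial of degree at most \<open>p ^ (f - 1)\<close>, so it
  cannot vanish at all \<open>p ^ f\<close> points, and \<open>prime_char\<close> takes the value 1
  only at 0.\<close>

lemma trace_char_nontrivial:
  assumes "card (fixed_field f :: 'b set) = p ^ f" "f > 0"
  shows "\<exists>c\<in>fixed_field f. trace_char f (c :: 'b) \<noteq> 1"
proof (rule ccontr)
  assume *: "\<not> ?thesis"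
  have p1: "p > 1" using prime_p prime_gt_1_nat by blast
  define g :: "'b poly" where "g = (\<Sum>i<f. monom 1 (p ^ i))"
  have "coeff g 1 = (\<Sum>i<f. if i = 0 then 1 else 0)"
    unfolding g_def coeff_sum using p1 by (intro sum.cong) auto
  also have "\<dots> = 1" using assms(2) by simp
  finally have g: "g \<noteq> 0" by auto
  have "degree g \<le> p ^ (f - 1)" unfolding g_def
    by (rule degree_sum_le) (use p1 in \<open>auto intro!: order.trans[OF degree_monom_le] power_increasing\<close>)
  also have "\<dots> < p ^ f" using p1 assms(2) by (intro power_strict_increasing) auto
  finally have deg: "degree g < p ^ f" .
  have "fixed_field f \<subseteq> {x. poly g x = 0}"
    using * by (auto simp: g_def poly_sum poly_monom trace_char_def prime_char_eq_1_iff
        ff_trace_in_prime_field ff_trace_def[symmetric] p_def)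
  then have "p ^ f \<le> card {x. poly g x = 0}"
    using assms(1) card_mono[OF poly_roots_finite[OF g]] by metis
  then show False using card_poly_roots_bound[OF g] deg by linarith
qed

text \<open>Transitivity of the trace: each exponent index below \<open>f * m\<close> is written
  uniquely as \<open>j * f + i\<close> with \<open>i < f\<close>.\<close>

lemma ff_trace_trans:
  "ff_trace (f * m) (x :: 'b) = ff_trace f (\<Sum>j<m. x ^ ((p ^ f) ^ j))"
proof -
  have "ff_trace f (\<Sum>j<m. x ^ ((p ^ f) ^ j)) = (\<Sum>i<f. \<Sum>j<m. x ^ (p ^ (j * f + i)))"
    by (simp add: ff_trace_def frob_pow_sum power_add mult.commute[of f] flip: p_def power_mult)
  also have "\<dots> = (\<Sum>j<m. \<Sum>i<f. x ^ (p ^ (j * f + i)))" by (rule sum.swap)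
  also have "\<dots> = (\<Sum>j<m. \<Sum>i\<in>{j * f..<j * f + f}. x ^ (p ^ i))"
  proof (rule sum.cong[OF refl])
    fix j
    show "(\<Sum>i<f. x ^ (p ^ (j * f + i))) = (\<Sum>i\<in>{j * f..<j * f + f}. x ^ (p ^ i))"
      by (rule sum.reindex_bij_witness[of _ "\<lambda>i. i - j * f" "\<lambda>i. j * f + i"]) auto
  qed
  also have "\<dots> = (\<Sum>i<m * f. x ^ (p ^ i))" by (rule sum.nat_group)
  finally show ?thesis by (simp add: ff_trace_def mult.commute flip: p_def)
qed

lemma trace_char_trans:
  "trace_char (f * m) (x :: 'b) = trace_char f (\<Sum>j<m. x ^ ((p ^ f) ^ j))"
  by (simp add: trace_char_def ff_trace_trans)

lemma fixed_field_simps: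
  "0 \<in> (fixed_field f :: 'b set)" "1 \<in> (fixed_field f :: 'b set)"
  "x \<in> fixed_field f \<Longrightarrow> y \<in> fixed_field f \<Longrightarrow> x + y \<in> (fixed_field f :: 'b set)"
  "x \<in> fixed_field f \<Longrightarrow> y \<in> fixed_field f \<Longrightarrow> x * y \<in> (fixed_field f :: 'b set)"
  "x \<in> fixed_field f \<Longrightarrow> - x \<in> (fixed_field f :: 'b set)"
  "x \<in> fixed_field f \<Longrightarrow> x ^ k \<in> (fixed_field f :: 'b set)"
  "x \<in> fixed_field f \<Longrightarrow> inverse x \<in> (fixed_field f :: 'b set)"
proof -
  have "p ^ f \<noteq> 0" using prime_p by (simp add: prime_gt_0_nat)
  then show "0 \<in> (fixed_field f :: 'b set)" by (simp add: fixed_field_def flip: p_def)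
  show "1 \<in> (fixed_field f :: 'b set)" by (simp add: fixed_field_def)
qed (auto simp: fixed_field_def frob_pow_add frob_pow_minus power_mult_distrib power_inverse mult.commute[of k] 
       power_mult simp flip: p_def intro: arg_cong[of _ _ "\<lambda>x. x ^ k"], metis mult.commute power_mult)

lemma fixed_field_mono: "f dvd g \<Longrightarrow> (fixed_field f :: 'b set) \<subseteq> fixed_field g"
proof -
  assume "f dvd g"
  then obtain m where g: "g = f * m" by (elim dvdE)
  have "x ^ ((p ^ f) ^ m) = x" if "x ^ (p ^ f) = x" for x :: 'b
    by (induction m) (simp_all add: power_mult that)
  then show ?thesis by (auto simp: fixed_field_def g power_mult simp flip: p_def)
qed

end

section \<open>Order, generators and subfields of a finite field\<close>

lemma prime_CHAR_finite: "prime CHAR('a::{finite,field})"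
  using prime_CHAR_semidom[where ?'a = 'a] finite_imp_CHAR_pos[where ?'a = 'a] by simp

text \<open>Multiplication by \<open>x\<close> permutes the nonzero elements, so it leaves their
  product unchanged.\<close>

lemma power_card_minus_one:
  fixes x :: "'a::{finite,field}"
  assumes "x \<noteq> 0"
  shows "x ^ (CARD('a) - 1) = 1"
proof -
  have "(\<Prod>y\<in>UNIV-{0}. x * y) = (\<Prod>y\<in>UNIV-{0}. y)"
    by (rule prod.reindex_bij_witness[of _ "\<lambda>y. y / x" "\<lambda>y. x * y"]) (use assms in auto)
  then show ?thesis by (simp add: prod.distrib)
qed

lemma nat_mult_mem_subgroup:
  assumes "(0::'a::ring_1) \<in> V" "\<And>x y. x \<in> V \<Longrightarrow> y \<in> V \<Longrightarrow> x + y \<in> V" "x \<in> V"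
  shows "of_nat k * x \<in> V"
  by (induction k) (use assms in \<open>auto simp: ring_distribs\<close>)

text \<open>Two coinciding translates would put a multiple \<open>of_nat (j - i) * x\<close> with
  \<open>0 < j - i < p\<close> into \<open>V\<close>; as \<open>j - i\<close> is invertible modulo
  \<open>p\<close>, \<open>x\<close> itself would lie in \<open>V\<close>.\<close>

lemma additive_subgroup_extend:
  fixes V :: "'a::{finite,field} set"
  assumes V0: "0 \<in> V" and Vadd: "\<And>x y. x \<in> V \<Longrightarrow> y \<in> V \<Longrightarrow> x + y \<in> V" and x: "x \<notin> V"
  defines "V' \<equiv> (\<lambda>(v, i). v + of_nat i * x) ` (V \<times> {..<CHAR('a)})"
  shows "0 \<in> V'" "\<And>x y. x \<in> V' \<Longrightarrow> y \<in> V' \<Longrightarrow> x + y \<in> V'" "card V' = CHAR('a) * card V"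
proof -
  let ?p = "CHAR('a)"
  note p = prime_CHAR_finite[where ?'a = 'a]
  then have p0: "?p > 0" using prime_gt_0_nat by blast
  note cong = of_nat_eq_iff_cong[OF refl p]
  have sub: "v - w \<in> V" if "v \<in> V" "w \<in> V" for v w
  proof -
    have "of_nat (?p - 1) * w \<in> V" using V0 Vadd that(2) by (rule nat_mult_mem_subgroup)
    moreover have "of_nat (?p - 1) = (-1 :: 'a)" using p0 by (simp add: of_nat_diff)
    ultimately show ?thesis using Vadd[OF that(1)] by fastforce
  qed
  show "0 \<in> V'" unfolding V'_def by (rule image_eqI[of _ _ "(0, 0)"]) (use V0 p0 in auto)
  show "y + z \<in> V'" if yz: "y \<in> V'" "z \<in> V'" for y z
  proof -
    obtain v i w j where *: "y = v + of_nat i * x" "z = w + of_nat j * x" "v \<in> V" "w \<in> V"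
      using yz by (auto simp: V'_def)
    have "of_nat ((i + j) mod ?p) = (of_nat (i + j) :: 'a)" by (subst cong) simp
    then have "y + z = (v + w) + of_nat ((i + j) mod ?p) * x" by (simp add: * ring_distribs)
    then show ?thesis unfolding V'_def
      by (intro image_eqI[of _ _ "(v + w, (i + j) mod ?p)"]) (use * Vadd p0 in auto)
  qed
  have "inj_on (\<lambda>(v, i). v + of_nat i * x) (V \<times> {..<?p})"
  proof (rule inj_onI, clarify)
    fix v i w j assume *: "v \<in> V" "w \<in> V" "i < ?p" "j < ?p" "v + of_nat i * x = w + of_nat j * x"
    have no: False if h: "v \<in> V" "w \<in> V" "i < j" "j < ?p" "v + of_nat i * x = w + of_nat j * x" for v w i j
    proof -
      have eq: "of_nat (j - i) * x = v - w" using h by (simp add: of_nat_diff algebra_simps)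
      have "\<not> ?p dvd j - i" using h by (auto dest: dvd_imp_le)
      then have "coprime (j - i) ?p" using p prime_imp_coprime coprime_commute by blast
      then obtain k where "[(j - i) * k = 1] (mod ?p)" using cong_solve_coprime_nat by (metis One_nat_def)
      then have "of_nat ((j - i) * k) = (1 :: 'a)" using cong[of "(j - i) * k" 1] by (simp add: cong_def)
      then have "x = of_nat k * (v - w)" by (simp add: mult_ac flip: eq)
      then show False using x nat_mult_mem_subgroup[OF V0 Vadd sub[OF h(1,2)], of k] by simp
    qed
    have "i = j" using no[of v w i j] no[of w v j i] * by (metis linorder_neqE_nat)
    then show "v = w \<and> i = j" using * by simp
  qed
  then show "card V' = ?p * card V" by (simp add: V'_def card_image card_cartesian_product mult.commute)
qed

text \<open>A largest additive subgroup of \<open>p\<close>-power order is the whole field, since a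
  proper one could be enlarged by a factor \<open>p\<close>.\<close>

lemma card_finite_field_prime_power: "\<exists>n. CARD('a::{finite,field}) = CHAR('a) ^ n"
proof -
  define P where "P V \<longleftrightarrow> 0 \<in> V \<and> (\<forall>x\<in>V. \<forall>y\<in>V. x + y \<in> V) \<and> (\<exists>k. card V = CHAR('a) ^ k)"
    for V :: "'a set"
  have "P {0}" by (auto simp: P_def intro: exI[of _ 0])
  then have "\<exists>V. P V \<and> (\<forall>W. P W \<longrightarrow> card W \<le> card V)"
    by (rule ex_has_greatest_nat[where b = "Suc CARD('a)"]) (simp add: card_mono less_Suc_eq_le)
  then obtain V where PV: "P V" and max: "\<And>W. P W \<Longrightarrow> card W \<le> card V" by blast
  note V = PV[unfolded P_def]
  have "V = UNIV"
  proof (rule ccontr)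
    assume "V \<noteq> UNIV"
    then obtain x where x: "x \<notin> V" by auto
    define V' where "V' = (\<lambda>(v, i). v + of_nat i * x) ` (V \<times> {..<CHAR('a)})"
    have "0 \<in> V" "\<And>x y. x \<in> V \<Longrightarrow> y \<in> V \<Longrightarrow> x + y \<in> V" using V by auto
    note ext = additive_subgroup_extend[OF this x, folded V'_def]
    obtain k where k: "card V = CHAR('a) ^ k" using V by blast
    have "card V' = CHAR('a) ^ Suc k" by (simp add: ext(3) k)
    then have "P V'" unfolding P_def using ext(1,2) by blast
    then have "CHAR('a) * card V \<le> card V" using max ext(3) by metis
    moreover have "CHAR('a) > 1" using prime_CHAR_finite prime_gt_1_nat by blast
    moreover have "card V > 0" using V by (auto simp: card_gt_0_iff)
    ultimately show False by (simp add: leD)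
  qed
  then show ?thesis using V by auto
qed

text \<open>This makes the definite description in \<open>fdeg\<close> meaningful: the exponent
  exists, and it is unique because the characteristic exceeds 1.\<close>

lemma CARD_eq_CHAR_power: "CARD('a::{finite,field}) = CHAR('a) ^ fdeg TYPE('a)"
  and fdeg_pos: "fdeg TYPE('a::{finite,field}) > 0"
proof -
  have p1: "CHAR('a) > 1" using prime_CHAR_finite prime_gt_1_nat by blast
  obtain n where n: "CARD('a) = CHAR('a) ^ n" using card_finite_field_prime_power by blast
  then have "fdeg TYPE('a) = n"
    unfolding fdeg_def by (rule the_equality) (use n p1 in auto)
  with n show *: "CARD('a) = CHAR('a) ^ fdeg TYPE('a)" by simp
  have "CARD('a) > 1" using card_mono[of UNIV "{0, 1 :: 'a}"] by simp
  then show "fdeg TYPE('a) > 0" using * by (cases "fdeg TYPE('a)") auto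
qed

lemma fixed_field_fdeg: "fixed_field (fdeg TYPE('a)) = (UNIV :: 'a::{finite,field} set)"
proof -
  have "x ^ CARD('a) = x" for x :: 'a
  proof (cases "x = 0")
    case False
    have "x ^ CARD('a) = x * x ^ (CARD('a) - 1)" using finite_UNIV_card_ge_0[where ?'a = 'a] by (simp flip: power_Suc)
    then show ?thesis using power_card_minus_one[OF False] by simp
  qed (simp add: finite_UNIV_card_ge_0)
  then show ?thesis by (auto simp: fixed_field_def simp flip: CARD_eq_CHAR_power)
qed

lemma psi_eq_trace_char: "psi (x :: 'a::{finite,field}) = trace_char (fdeg TYPE('a)) x"
  by (simp add: psi_def trace_char_def prime_char_def abs_trace_def ff_trace_def)

lemma finite_field_generator:
  "\<exists>g :: 'a::{finite,field}. g \<noteq> 0 \<and> (\<forall>x. x \<noteq> 0 \<longrightarrow> (\<exists>i::nat. x = g ^ i))"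
proof -
  define R :: "'a ring" where "R = ring_of_type_algebra"
  interpret field R unfolding R_def by (rule field_from_type_algebra)
  have carrier: "carrier R - {\<zero>\<^bsub>R\<^esub>} = UNIV - {0}"
    by (simp add: R_def ring_of_type_algebra_def)
  have pow: "a [^]\<^bsub>R\<^esub> i = a ^ i" for a and i :: nat
    by (induction i) (simp_all add: R_def ring_of_type_algebra_def)
  have "finite (carrier R)" by (simp add: R_def ring_of_type_algebra_def)
  from finite_field_mult_group_has_gen[OF this]
  have "\<exists>a \<in> UNIV - {0 :: 'a}. UNIV - {0} = {a ^ i | i :: nat. i \<in> UNIV}"
    unfolding Multiplicative_Group.carrier_mult_of carrier pow .
  then obtain a where a: "a \<in> UNIV - {0 :: 'a}" and eq: "UNIV - {0} = {a ^ i | i :: nat. i \<in> UNIV}"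
    by (rule bexE)
  show ?thesis
  proof (intro exI[of _ a] conjI allI impI)
    show "a \<noteq> 0" using a by simp
    fix x :: 'a assume "x \<noteq> 0"
    then have "x \<in> {a ^ i | i :: nat. i \<in> UNIV}" unfolding eq[symmetric] by simp
    then show "\<exists>i::nat. x = a ^ i" by simp
  qed
qed

text \<open>If \<open>g\<close> generates the unit group of the whole field, of order
  \<open>N * e\<close>, then \<open>g ^ e\<close> generates the solutions of
  \<open>x ^ N = 1\<close>, which are the units of the subfield.\<close>

lemma fixed_field_generator:
  assumes "f dvd fdeg TYPE('a::{finite,field})" "f > 0"
  defines "N \<equiv> CHAR('a::{finite,field}) ^ f - 1"
  obtains \<theta> :: "'a::{finite,field}" where "\<theta> \<noteq> 0" "\<theta> ^ N = 1" "bij_betw (\<lambda>k. \<theta> ^ k) {..<N} (fixed_field f - {0})"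
    "\<And>i j. \<theta> ^ i = \<theta> ^ j \<longleftrightarrow> i mod N = j mod N"
proof -
  let ?q = "CARD('a)"
  have p1: "CHAR('a) > 1" using prime_CHAR_finite prime_gt_1_nat by blast
  have q1: "?q > 1" using card_mono[of UNIV "{0, 1 :: 'a}"] by simp
  have N0: "N > 0" using p1 assms(2) one_less_power[of "CHAR('a)" f] by (simp add: N_def)
  obtain g :: 'a where g: "g \<noteq> 0" "\<And>x. x \<noteq> 0 \<Longrightarrow> \<exists>i::nat. x = g ^ i"
    using finite_field_generator by blast
  have g1: "g ^ (?q - 1) = 1" using g(1) by (rule power_card_minus_one)
  have gmod: "g ^ i = g ^ (i mod (?q - 1))" for i
  proof -
    have "g ^ i = (g ^ (?q - 1)) ^ (i div (?q - 1)) * g ^ (i mod (?q - 1))"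
      by (metis div_mult_mod_eq mult.commute power_add power_mult)
    then show ?thesis unfolding g1 by simp
  qed
  have "UNIV - {0} \<subseteq> (\<lambda>i. g ^ i) ` {..<?q - 1}"
  proof
    fix x :: 'a assume "x \<in> UNIV - {0}"
    then obtain i where "x = g ^ i" using g(2) by auto
    then show "x \<in> (\<lambda>i. g ^ i) ` {..<?q - 1}" using gmod[of i] q1 by (intro image_eqI[of _ _ "i mod (?q - 1)"]) auto
  qed
  then have im: "(\<lambda>i. g ^ i) ` {..<?q - 1} = UNIV - {0}" using g(1) by auto
  then have inj: "inj_on (\<lambda>i. g ^ i) {..<?q - 1}" by (intro eq_card_imp_inj_on) (simp_all add: card_Diff_singleton)
  have geq: "g ^ i = g ^ j \<longleftrightarrow> i mod (?q - 1) = j mod (?q - 1)" for i j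
    using inj_onD[OF inj, of "i mod (?q - 1)" "j mod (?q - 1)"] gmod[of i] gmod[of j] q1 by auto
  obtain m where m: "fdeg TYPE('a) = f * m" using assms(1) by (elim dvdE)
  have "N dvd ?q - 1"
  proof -
    have "[CHAR('a) ^ f = 1] (mod N)" using p1 unfolding N_def
      by (simp add: cong_diff_iff_cong_0_nat' cong_altdef_nat)
    then have "[(CHAR('a) ^ f) ^ m = 1 ^ m] (mod N)" by (rule cong_pow)
    then show ?thesis using q1 by (simp add: CARD_eq_CHAR_power m power_mult cong_altdef_nat)
  qed
  then obtain e where e: "?q - 1 = N * e" by (elim dvdE)
  have e0: "e > 0" using e q1 by (cases e) auto
  define \<theta> where "\<theta> = g ^ e"
  have eq: "\<theta> ^ i = \<theta> ^ j \<longleftrightarrow> i mod N = j mod N" for i j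
  proof -
    have "\<theta> ^ i = \<theta> ^ j \<longleftrightarrow> (e * i) mod (e * N) = (e * j) mod (e * N)"
      using geq[of "e * i" "e * j"] by (simp only: e \<theta>_def power_mult mult.commute[of N])
    then show ?thesis using e0 by (simp flip: mult_mod_right)
  qed
  have 1: "\<theta> ^ N = 1" using eq[of N 0] by simp
  have fixed_iff: "x \<in> fixed_field f - {0} \<longleftrightarrow> x ^ N = 1" for x :: 'a
  proof -
    have "x ^ (CHAR('a) ^ f) = x * x ^ N" using p1 by (simp add: N_def flip: power_Suc)
    moreover have "x = 0 \<Longrightarrow> x ^ N \<noteq> 1" using N0 by (simp add: power_0_left)
    ultimately show ?thesis by (auto simp: fixed_field_def)
  qed
  have bij: "bij_betw (\<lambda>k. \<theta> ^ k) {..<N} (fixed_field f - {0})"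
  proof (rule bij_betwI')
    show "\<theta> ^ i = \<theta> ^ j \<longleftrightarrow> i = j" if "i \<in> {..<N}" "j \<in> {..<N}" for i j
      using that by (simp add: eq)
    show "\<theta> ^ i \<in> fixed_field f - {0}" for i
      proof -
      have "(\<theta> ^ i) ^ N = (\<theta> ^ N) ^ i" by (simp only: power_mult[symmetric] mult.commute)
      then show ?thesis unfolding fixed_iff using 1 by simp
    qed
    show "\<exists>i\<in>{..<N}. x = \<theta> ^ i" if "x \<in> fixed_field f - {0}" for x
    proof -
      have x: "x ^ N = 1" "x \<noteq> 0" using that fixed_iff by auto
      then obtain i where i: "x = g ^ i" using g(2) by auto
      have "g ^ (i * N) = g ^ 0" using x(1) by (simp add: i power_mult)
      then have "(i * N) mod (N * e) = 0" by (simp only: geq e mod_0)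
      then have "N * e dvd N * i" by (simp only: mult.commute[of i] mod_0_imp_dvd)
      then have "e dvd i" using N0 by simp
      then obtain k where k: "i = e * k" by (elim dvdE)
      have "x = \<theta> ^ k" by (simp add: i k \<theta>_def power_mult)
      also have "\<dots> = \<theta> ^ (k mod N)" by (simp add: eq)
      finally show ?thesis using N0 by (intro bexI[of _ "k mod N"]) auto
    qed
  qed
  have "\<theta> \<noteq> 0" using g(1) by (simp add: \<theta>_def)
  from that[OF this 1 bij eq] show thesis .
qed

lemma card_fixed_field:
  assumes "f dvd fdeg TYPE('a::{finite,field})" "f > 0"
  shows "card (fixed_field f :: 'a set) = CHAR('a) ^ f"
proof -
  obtain \<theta> :: 'a where bij: "bij_betw (\<lambda>k. \<theta> ^ k) {..<CHAR('a) ^ f - 1} (fixed_field f - {0})"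
    by (rule fixed_field_generator[OF assms])
  have "card (fixed_field f - {0 :: 'a}) = CHAR('a) ^ f - 1"
    using bij_betw_same_card[OF bij] by simp
  moreover have "card (fixed_field f :: 'a set) > 0" using fixed_field_simps(1)[OF refl prime_CHAR_finite, of f] by (auto simp: card_gt_0_iff)
  moreover have "0 \<in> (fixed_field f :: 'a set)" using fixed_field_simps[OF refl prime_CHAR_finite] by blast
  moreover have "CHAR('a) ^ f > 0" using prime_gt_0_nat[OF prime_CHAR_finite[where ?'a = 'a]] by (rule zero_less_power)
  ultimately show ?thesis by (simp only: card_Diff_singleton)
qed

section \<open>Power moments of Weil sums\<close>

text \<open>The field is a subset of an ambient type, so that the same moment formulas serve the
  whole field and every subfield in the tower.\<close>

locale field_character =
  fixes S :: "'b::field set" and \<psi> :: "'b \<Rightarrow> complex"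
  assumes finite_S [simp]: "finite S"
    and zero_S [simp]: "0 \<in> S" and one_S [simp]: "1 \<in> S"
    and add_S: "\<And>x y. x \<in> S \<Longrightarrow> y \<in> S \<Longrightarrow> x + y \<in> S"
    and mult_S: "\<And>x y. x \<in> S \<Longrightarrow> y \<in> S \<Longrightarrow> x * y \<in> S"
    and minus_S: "\<And>x. x \<in> S \<Longrightarrow> - x \<in> S"
    and inverse_S: "\<And>x. x \<in> S \<Longrightarrow> inverse x \<in> S"
    and psi_0 [simp]: "\<psi> 0 = 1"
    and psi_add: "\<And>x y. x \<in> S \<Longrightarrow> y \<in> S \<Longrightarrow> \<psi> (x + y) = \<psi> x * \<psi> y"
    and psi_nontrivial: "\<exists>c\<in>S. \<psi> c \<noteq> 1"
begin

lemma power_S: "x \<in> S \<Longrightarrow> x ^ k \<in> S"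
  by (induction k) (auto simp: mult_S)

lemma divide_S: "x \<in> S \<Longrightarrow> y \<in> S \<Longrightarrow> x / y \<in> S"
  by (simp add: divide_inverse mult_S inverse_S)

lemma diff_S: "x \<in> S \<Longrightarrow> y \<in> S \<Longrightarrow> x - y \<in> S"
  using add_S[of x "- y"] by (simp add: minus_S)

lemmas closed = add_S mult_S minus_S inverse_S power_S divide_S diff_S

lemma card_S: "card S \<noteq> 0"
  by (metis card_eq_0_iff empty_iff finite_S zero_S)

lemma sum_scale:
  assumes "c \<in> S" "c \<noteq> 0"
  shows "(\<Sum>x\<in>S. h (c * x)) = (\<Sum>x\<in>S. h x)"
  by (rule sum.reindex_bij_witness[of _ "\<lambda>x. x / c" "\<lambda>x. c * x"]) (use assms in \<open>auto simp: closed\<close>)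

lemma sum_psi: "(\<Sum>x\<in>S. \<psi> x) = 0"
proof -
  obtain c where c: "c \<in> S" "\<psi> c \<noteq> 1" using psi_nontrivial by blast
  have "(\<Sum>x\<in>S. \<psi> x) = (\<Sum>x\<in>S. \<psi> (c + x))"
    by (rule sum.reindex_bij_witness[of _ "\<lambda>x. c + x" "\<lambda>x. x - c"]) (use c in \<open>auto simp: closed\<close>)
  also have "\<dots> = \<psi> c * (\<Sum>x\<in>S. \<psi> x)" using c by (simp add: psi_add sum_distrib_left)
  finally show ?thesis using c(2) by simp
qed

lemma sum_psi_mult: "c \<in> S \<Longrightarrow> (\<Sum>x\<in>S. \<psi> (c * x)) = (if c = 0 then of_nat (card S) else 0)"
  using sum_scale[of c \<psi>] sum_psi by auto

definition gauss :: "('b \<Rightarrow> complex) \<Rightarrow> complex" where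
  "gauss \<kappa> = (\<Sum>x\<in>S. \<psi> x * \<kappa> x)"

definition wsum :: "nat \<Rightarrow> 'b \<Rightarrow> complex" where
  "wsum D a = (\<Sum>x\<in>S. \<psi> (x ^ D + a * x))"

section \<open>Transforms and moments of Weil sums for a permutation exponent\<close>

context
  fixes D :: nat
  assumes D: "D > 0" and bij: "bij_betw (\<lambda>x. x ^ D) S S"
begin

text \<open>If the power were 1, injectivity of the power map would give \<open>-1 = 1\<close>, and
  then the two possible values coincide anyway.\<close>

lemma minus_one_power: "(- 1 :: 'b) ^ D = - 1"
proof (rule ccontr)
  assume "(- 1 :: 'b) ^ D \<noteq> - 1"
  then have "(- 1 :: 'b) ^ D = 1 ^ D" by (cases "even D") auto
  then have "(- 1 :: 'b) = 1" using inj_onD[OF bij_betw_imp_inj_on[OF bij], of "- 1" 1] by (simp add: closed)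
  then show False using \<open>(- 1 :: 'b) ^ D \<noteq> - 1\<close> \<open>(- 1 :: 'b) ^ D = 1 ^ D\<close> by (metis power_one)
qed

lemma minus_power: "(- x) ^ D = - (x ^ D :: 'b)"
  using power_mult_distrib[of "- 1" x D] by (simp add: minus_one_power)

lemma sum_power: "(\<Sum>x\<in>S. h (x ^ D)) = (\<Sum>x\<in>S. h x)"
  by (rule sum.reindex_bij_betw[OF bij])

text \<open>Summing over \<open>a\<close> first, orthogonality leaves only \<open>x = - y\<close>.
  All moments below follow from this transform.\<close>

lemma wsum_fourier:
  assumes y: "y \<in> S"
  shows "(\<Sum>a\<in>S. wsum D a * \<psi> (a * y)) = of_nat (card S) * \<psi> (- (y ^ D))"
proof -
  have "(\<Sum>a\<in>S. wsum D a * \<psi> (a * y)) = (\<Sum>a\<in>S. \<Sum>x\<in>S. \<psi> (x ^ D) * \<psi> ((x + y) * a))"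
    unfolding wsum_def sum_distrib_right
  proof (intro sum.cong refl)
    fix a x assume ax: "a \<in> S" "x \<in> S"
    have "\<psi> ((x + y) * a) = \<psi> (a * x) * \<psi> (a * y)"
      using ax y by (simp add: psi_add closed ring_distribs mult.commute[of _ a] flip: psi_add)
    then show "\<psi> (x ^ D + a * x) * \<psi> (a * y) = \<psi> (x ^ D) * \<psi> ((x + y) * a)"
      using ax by (simp add: psi_add closed)
  qed
  also have "\<dots> = (\<Sum>x\<in>S. \<psi> (x ^ D) * (\<Sum>a\<in>S. \<psi> ((x + y) * a)))"
    by (subst sum.swap) (simp add: sum_distrib_left)
  also have "\<dots> = (\<Sum>x\<in>S. if x = - y then \<psi> (x ^ D) * of_nat (card S) else 0)"
    using y by (intro sum.cong) (auto simp: sum_psi_mult closed add_eq_0_iff2)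
  also have "\<dots> = of_nat (card S) * \<psi> (- (y ^ D))"
    using y by (simp add: closed minus_power)
  finally show ?thesis .
qed

lemma wsum_0: "wsum D 0 = 0"
  using sum_power[of \<psi>] by (simp add: wsum_def sum_psi)

lemma sum_wsum: "(\<Sum>a\<in>S. wsum D a) = of_nat (card S)"
  using wsum_fourier[of 0] D by (simp add: zero_power)

text \<open>One factor is expanded by definition and the other summed by
  \<open>wsum_fourier\<close>; the two character values at \<open>y\<close> cancel.\<close>

lemma sum_wsum_square: "(\<Sum>a\<in>S. wsum D a ^ 2) = of_nat (card S) ^ 2"
proof -
  have "(\<Sum>a\<in>S. wsum D a ^ 2) = (\<Sum>a\<in>S. \<Sum>y\<in>S. \<psi> (y ^ D) * (wsum D a * \<psi> (a * y)))"
  proof (rule sum.cong[OF refl])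
    fix a assume a: "a \<in> S"
    have "wsum D a ^ 2 = (\<Sum>y\<in>S. wsum D a * \<psi> (y ^ D + a * y))"
      by (simp add: power2_eq_square wsum_def[of D a] flip: sum_distrib_left)
    then show "wsum D a ^ 2 = (\<Sum>y\<in>S. \<psi> (y ^ D) * (wsum D a * \<psi> (a * y)))"
      using a by (simp add: psi_add closed mult_ac)
  qed
  also have "\<dots> = (\<Sum>y\<in>S. \<psi> (y ^ D) * (\<Sum>a\<in>S. wsum D a * \<psi> (a * y)))"
    by (subst sum.swap) (simp add: sum_distrib_left)
  also have "\<dots> = (\<Sum>y\<in>S. of_nat (card S))"
    by (intro sum.cong refl) (simp add: wsum_fourier closed flip: psi_add)
  finally show ?thesis by (simp add: power2_eq_square)
qed

text \<open>Two factors are expanded and the third summed by \<open>wsum_fourier\<close> at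
  \<open>y + z\<close>. The phase \<open>y ^ D + z ^ D - (y + z) ^ D\<close> is homogeneous, and for
  \<open>z\<close> nonzero the substitution \<open>y = z * t\<close> separates it into a function of
  \<open>t\<close> times \<open>z ^ D\<close>.\<close>

lemma sum_wsum_cube:
  "(\<Sum>a\<in>S. wsum D a ^ 3) = of_nat (card S) ^ 2 * of_nat (card {t\<in>S. (t + 1) ^ D = t ^ D + 1})"
proof -
  let ?U = "{t\<in>S. (t + 1) ^ D = t ^ D + 1}"
  have "(\<Sum>a\<in>S. wsum D a ^ 3)
    = (\<Sum>a\<in>S. \<Sum>y\<in>S. \<Sum>z\<in>S. \<psi> (y ^ D + z ^ D) * (wsum D a * \<psi> (a * (y + z))))"
  proof (rule sum.cong[OF refl])
    fix a assume a: "a \<in> S"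
    have "wsum D a ^ 3 = wsum D a * ((\<Sum>y\<in>S. \<psi> (y ^ D + a * y)) * (\<Sum>z\<in>S. \<psi> (z ^ D + a * z)))"
      by (simp add: power3_eq_cube wsum_def[symmetric])
    also have "\<dots> = (\<Sum>y\<in>S. \<Sum>z\<in>S. wsum D a * (\<psi> (y ^ D + a * y) * \<psi> (z ^ D + a * z)))"
      by (subst sum_product) (simp only: sum_distrib_left)
    also have "\<dots> = (\<Sum>y\<in>S. \<Sum>z\<in>S. \<psi> (y ^ D + z ^ D) * (wsum D a * \<psi> (a * (y + z))))"
      using a by (intro sum.cong refl) (simp add: psi_add closed ring_distribs mult_ac)
    finally show "wsum D a ^ 3 = \<dots>" .
  qed
  also have "\<dots> = (\<Sum>y\<in>S. \<Sum>z\<in>S. \<Sum>a\<in>S. \<psi> (y ^ D + z ^ D) * (wsum D a * \<psi> (a * (y + z))))"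
    by (subst sum.swap, rule sum.cong[OF refl], rule sum.swap)
  also have "\<dots> = (\<Sum>y\<in>S. \<Sum>z\<in>S. of_nat (card S) * \<psi> (y ^ D + z ^ D - (y + z) ^ D))"
  proof (intro sum.cong refl)
    fix y z assume yz: "y \<in> S" "z \<in> S"
    have "(\<Sum>a\<in>S. \<psi> (y ^ D + z ^ D) * (wsum D a * \<psi> (a * (y + z))))
      = \<psi> (y ^ D + z ^ D) * (of_nat (card S) * \<psi> (- ((y + z) ^ D)))"
      using yz by (simp add: wsum_fourier closed flip: sum_distrib_left)
    also have "\<dots> = of_nat (card S) * \<psi> ((y ^ D + z ^ D) + - ((y + z) ^ D))"
      using yz by (subst psi_add) (simp_all add: closed)
    finally show "(\<Sum>a\<in>S. \<psi> (y ^ D + z ^ D) * (wsum D a * \<psi> (a * (y + z))))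
      = of_nat (card S) * \<psi> (y ^ D + z ^ D - (y + z) ^ D)" by simp
  qed
  also have "\<dots> = of_nat (card S) * (\<Sum>z\<in>S. \<Sum>y\<in>S. \<psi> (y ^ D + z ^ D - (y + z) ^ D))"
    by (subst sum.swap) (simp add: sum_distrib_left)
  \<comment> \<open>The terms with \<open>z = 0\<close> do not allow the substitution; they
    contribute \<open>card S\<close>, which the \<open>-1\<close> per \<open>t\<close> in the
    remaining sum cancels.\<close>
  also have "(\<Sum>z\<in>S. \<Sum>y\<in>S. \<psi> (y ^ D + z ^ D - (y + z) ^ D)) =
      (\<Sum>y\<in>S. \<psi> (y ^ D + 0 ^ D - (y + 0) ^ D)) +
      (\<Sum>z\<in>S - {0}. \<Sum>y\<in>S. \<psi> (y ^ D + z ^ D - (y + z) ^ D))"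
    by (subst sum.remove[of S 0]) auto
  also have "(\<Sum>y\<in>S. \<psi> (y ^ D + 0 ^ D - (y + 0) ^ D)) = of_nat (card S)"
    using D by (simp add: zero_power)
  also have "(\<Sum>z\<in>S - {0}. \<Sum>y\<in>S. \<psi> (y ^ D + z ^ D - (y + z) ^ D))
      = (\<Sum>z\<in>S - {0}. \<Sum>t\<in>S. \<psi> ((t ^ D + 1 - (t + 1) ^ D) * z ^ D))"
  proof (rule sum.cong[OF refl])
    fix z assume z: "z \<in> S - {0}"
    have "(\<Sum>y\<in>S. \<psi> (y ^ D + z ^ D - (y + z) ^ D)) = (\<Sum>t\<in>S. \<psi> ((z * t) ^ D + z ^ D - (z * t + z) ^ D))"
      using z sum_scale[of z "\<lambda>y. \<psi> (y ^ D + z ^ D - (y + z) ^ D)"] by simp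
    also have "\<dots> = (\<Sum>t\<in>S. \<psi> ((t ^ D + 1 - (t + 1) ^ D) * z ^ D))"
    proof (rule sum.cong[OF refl])
      fix t
      have "(z * t + z) ^ D = (t + 1) ^ D * z ^ D"
        by (simp add: algebra_simps flip: power_mult_distrib)
      then show "\<psi> ((z * t) ^ D + z ^ D - (z * t + z) ^ D) = \<psi> ((t ^ D + 1 - (t + 1) ^ D) * z ^ D)"
        by (simp add: power_mult_distrib algebra_simps)
    qed
    finally show "(\<Sum>y\<in>S. \<psi> (y ^ D + z ^ D - (y + z) ^ D)) = \<dots>" .
  qed
  also have "\<dots> = (\<Sum>t\<in>S. \<Sum>z\<in>S - {0}. \<psi> ((t ^ D + 1 - (t + 1) ^ D) * z ^ D))"
    by (rule sum.swap)
  also have "\<dots> = (\<Sum>t\<in>S. of_nat (card S) * of_bool (t \<in> ?U) - 1)"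
  proof (rule sum.cong[OF refl])
    fix t assume t: "t \<in> S"
    let ?c = "t ^ D + 1 - (t + 1) ^ D"
    have "(\<Sum>z\<in>S. \<psi> (?c * z ^ D)) = (if ?c = 0 then of_nat (card S) else 0)"
      using sum_power[of "\<lambda>z. \<psi> (?c * z)"] sum_psi_mult[of ?c] t by (simp add: closed)
    moreover have "(\<Sum>z\<in>S. \<psi> (?c * z ^ D)) = 1 + (\<Sum>z\<in>S - {0}. \<psi> (?c * z ^ D))"
      using D by (subst sum.remove[of S 0]) (auto simp: zero_power)
    ultimately have sum: "(\<Sum>z\<in>S - {0}. \<psi> (?c * z ^ D)) = (if ?c = 0 then of_nat (card S) else 0) - 1"
      by (simp only: eq_diff_eq add.commute[of _ 1])
    have "t \<in> ?U \<longleftrightarrow> (t + 1) ^ D = t ^ D + 1" using t by simp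
    also have "\<dots> \<longleftrightarrow> ?c = 0" by (simp only: right_minus_eq) (rule eq_commute)
    finally have "of_bool (t \<in> ?U) = (if ?c = 0 then 1 else 0 :: complex)" by (simp only: of_bool_def)
    then show "(\<Sum>z\<in>S - {0}. \<psi> (?c * z ^ D)) = of_nat (card S) * of_bool (t \<in> ?U) - 1"
      unfolding sum by (simp only: split: if_split) simp
  qed
  also have "\<dots> = of_nat (card S) * of_nat (card ?U) - of_nat (card S)"
  proof -
    have "(\<Sum>t\<in>S. of_bool (t \<in> ?U) :: complex) = of_nat (card ?U)"
    proof -
      have "?U = S \<inter> {t. t \<in> ?U}" by blast
      then have "(\<Sum>t\<in>?U. 1 :: complex) = (\<Sum>t\<in>S. if t \<in> ?U then 1 else 0)"
        using sum.inter_restrict[OF finite_S, of "\<lambda>_. 1 :: complex" ?U] by simp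
      then show ?thesis by (simp only: of_bool_def sum_constant mult_1_right)
    qed
    then show ?thesis by (simp add: sum_subtractf flip: sum_distrib_left)
  qed
  finally show ?thesis by (simp add: power2_eq_square)
qed

text \<open>Invariance passes to the Fourier transform, so multiplication by
  \<open>b ^ D - 1\<close> sends every element to one where the character is 1. A nontrivial
  character then forces \<open>b ^ D = 1\<close>, and injectivity gives
  \<open>b = 1\<close>.\<close>

lemma wsum_scale_invariant:
  assumes b: "b \<in> S" "b \<noteq> 0" and inv: "\<And>a. a \<in> S \<Longrightarrow> wsum D (b * a) = wsum D a"
  shows "b = 1"
proof -
  have eq: "\<psi> ((b ^ D - 1) * x ^ D) = 1" if x: "x \<in> S" for x
  proof -
    \<comment> \<open>The sign compensates the one on the right side of
      \<open>wsum_fourier\<close>.\<close>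
    define y where "y = - x"
    have y: "y \<in> S" using x by (simp add: y_def closed)
    have "of_nat (card S) * \<psi> (- ((b * y) ^ D)) = (\<Sum>a\<in>S. wsum D (b * a) * \<psi> ((b * a) * y))"
      using b y inv by (simp add: wsum_fourier[symmetric] closed mult_ac)
    also have "\<dots> = (\<Sum>a\<in>S. wsum D a * \<psi> (a * y))"
      by (rule sum_scale[OF b, of "\<lambda>a. wsum D a * \<psi> (a * y)"])
    also have "\<dots> = of_nat (card S) * \<psi> (- (y ^ D))" by (rule wsum_fourier[OF y])
    finally have *: "\<psi> (b ^ D * x ^ D) = \<psi> (x ^ D)"
      using card_S by (simp add: y_def power_mult_distrib minus_power)
    have "\<psi> (b ^ D * x ^ D) = \<psi> ((b ^ D - 1) * x ^ D + x ^ D)" by (simp add: algebra_simps)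
    also have "\<dots> = \<psi> ((b ^ D - 1) * x ^ D) * \<psi> (x ^ D)"
      using b x by (intro psi_add) (simp_all add: closed)
    finally have "\<psi> ((b ^ D - 1) * x ^ D) * \<psi> (x ^ D) = \<psi> (x ^ D)" using * by simp
    moreover have "\<psi> (x ^ D) * \<psi> (- (x ^ D)) = 1"
      using x by (simp add: closed flip: psi_add)
    ultimately show ?thesis by auto
  qed
  have "(\<Sum>x\<in>S. \<psi> ((b ^ D - 1) * x)) = (\<Sum>x\<in>S. \<psi> ((b ^ D - 1) * x ^ D))"
    by (rule sum_power[symmetric])
  also have "\<dots> = of_nat (card S)" by (simp add: eq)
  finally have "b ^ D = 1 ^ D" using sum_psi_mult[of "b ^ D - 1"] b card_S by (auto simp: closed split: if_splits)
  then show ?thesis using inj_onD[OF bij_betw_imp_inj_on[OF bij]] b by simp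
qed

text \<open>The Mellin transform splits into two Gauss sums. The sum over \<open>a\<close> gives
  \<open>inverse (\<kappa> x)\<close>, and \<open>E\<close>, inverting the power map, rewrites it as
  a function of \<open>x ^ D\<close>.\<close>

lemma wsum_mellin:
  assumes mult: "\<And>x y. x \<in> S \<Longrightarrow> y \<in> S \<Longrightarrow> \<kappa> (x * y) = \<kappa> x * \<kappa> y"
    and k0: "\<kappa> 0 = 0" and k1: "\<kappa> 1 = 1" and sum: "(\<Sum>x\<in>S. \<kappa> x) = 0"
    and E: "\<And>x. x \<in> S \<Longrightarrow> (x ^ D) ^ E = x"
  shows "(\<Sum>a\<in>S. wsum D a * \<kappa> a) = gauss \<kappa> * gauss (\<lambda>x. inverse (\<kappa> (x ^ E)))"
proof -
  \<comment> \<open>At \<open>x = 0\<close> the left side vanishes by orthogonality and the right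
    side because \<open>inverse 0 = 0\<close>.\<close>
  have inner: "(\<Sum>a\<in>S. \<psi> (a * x) * \<kappa> a) = inverse (\<kappa> x) * gauss \<kappa>" if x: "x \<in> S" for x
  proof (cases "x = 0")
    case False
    have "\<kappa> x * \<kappa> (inverse x) = 1" using mult[of x "inverse x"] x False k1 by (simp add: closed)
    then have inv: "\<kappa> x * inverse (\<kappa> x) = 1" by (metis mult_zero_left right_inverse zero_neq_one)
    have "gauss \<kappa> = (\<Sum>a\<in>S. \<psi> (x * a) * \<kappa> (x * a))"
      unfolding gauss_def using sum_scale[OF x False, of "\<lambda>a. \<psi> a * \<kappa> a"] by simp
    also have "\<dots> = \<kappa> x * (\<Sum>a\<in>S. \<psi> (a * x) * \<kappa> a)"
      using x by (simp add: mult sum_distrib_left mult_ac)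
    finally show ?thesis using inv by (metis mult.assoc mult.commute mult_1)
  qed (simp add: sum k0)
  have "(\<Sum>a\<in>S. wsum D a * \<kappa> a) = (\<Sum>a\<in>S. \<Sum>x\<in>S. \<psi> (x ^ D) * (\<psi> (a * x) * \<kappa> a))"
    unfolding wsum_def sum_distrib_right by (intro sum.cong refl) (simp add: psi_add closed mult_ac)
  also have "\<dots> = (\<Sum>x\<in>S. \<psi> (x ^ D) * (\<Sum>a\<in>S. \<psi> (a * x) * \<kappa> a))"
    by (subst sum.swap) (simp add: sum_distrib_left)
  also have "\<dots> = gauss \<kappa> * (\<Sum>x\<in>S. \<psi> (x ^ D) * inverse (\<kappa> ((x ^ D) ^ E)))"
  proof -
    have "(\<Sum>x\<in>S. \<psi> (x ^ D) * (\<Sum>a\<in>S. \<psi> (a * x) * \<kappa> a))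
        = (\<Sum>x\<in>S. \<psi> (x ^ D) * (inverse (\<kappa> ((x ^ D) ^ E)) * gauss \<kappa>))"
      by (intro sum.cong refl) (simp add: inner E)
    then show ?thesis by (simp add: sum_distrib_left mult_ac)
  qed
  also have "(\<Sum>x\<in>S. \<psi> (x ^ D) * inverse (\<kappa> ((x ^ D) ^ E))) = gauss (\<lambda>x. inverse (\<kappa> (x ^ E)))"
    unfolding gauss_def by (rule sum_power)
  finally show ?thesis .
qed

end
end

lemma field_character_fixed_field:
  assumes "f dvd fdeg TYPE('a::{finite,field})" "f > 0"
  shows "field_character (fixed_field f :: 'a set) (trace_char f)"
proof -
  note p = refl prime_CHAR_finite[where ?'a = 'a]
  note simps = fixed_field_simps[OF p, where f = f]
  show ?thesis
  proof
    have "CHAR('a) ^ f > 0" using prime_gt_0_nat[OF p(2)] by (rule zero_less_power)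
    then show "finite (fixed_field f :: 'a set)" by simp
  qed (use simps trace_char_add[OF p] trace_char_0[OF p]
      trace_char_nontrivial[OF p card_fixed_field[OF assms] assms(2)] in auto)
qed

section \<open>Irreducibility of the cyclotomic polynomial\<close>

text \<open>Evaluating one integer polynomial both at complex numbers and in characteristic
  \<open>p\<close> is what carries identities between roots of unity over to congruences.\<close>

definition ipoly :: "int poly \<Rightarrow> 'b::comm_ring_1 \<Rightarrow> 'b" where
  "ipoly f x = poly (map_poly of_int f) x"

lemma map_poly_of_int_add: "map_poly of_int (f + g) = (map_poly of_int f + map_poly of_int g :: 'b::comm_ring_1 poly)"
  by (rule poly_eqI) (simp add: coeff_map_poly)

lemma map_poly_of_int_mult: "map_poly of_int (f * g) = (map_poly of_int f * map_poly of_int g :: 'b::comm_ring_1 poly)"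
  by (rule poly_eqI) (simp add: coeff_map_poly coeff_mult)

lemma ipoly_add [simp]: "ipoly (f + g) x = ipoly f x + ipoly g x"
  by (simp add: ipoly_def map_poly_of_int_add)

lemma ipoly_mult [simp]: "ipoly (f * g) x = ipoly f x * ipoly g x"
  by (simp add: ipoly_def map_poly_of_int_mult)

lemma ipoly_0 [simp]: "ipoly 0 x = 0" and ipoly_1 [simp]: "ipoly 1 x = 1"
  by (simp_all add: ipoly_def map_poly_1')

lemma ipoly_pCons [simp]: "ipoly (pCons a f) x = of_int a + x * ipoly f x"
  by (simp add: ipoly_def map_poly_pCons)

lemma ipoly_smult [simp]: "ipoly (smult c f) x = of_int c * ipoly f x"
  using ipoly_mult[of "[:c:]" f x] by simp

lemma ipoly_minus [simp]: "ipoly (- f) x = - ipoly f x"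
  using ipoly_smult[of "-1" f x] by simp

lemma ipoly_diff [simp]: "ipoly (f - g) x = ipoly f x - ipoly g x"
  using ipoly_add[of f "- g" x] by simp

lemma ipoly_power [simp]: "ipoly (f ^ n) x = ipoly f x ^ n"
  by (induction n) auto

lemma ipoly_sum [simp]: "ipoly (\<Sum>a\<in>A. f a) x = (\<Sum>a\<in>A. ipoly (f a) x)"
  by (induction A rule: infinite_finite_induct) auto

lemma ipoly_monom [simp]: "ipoly (monom c n) x = of_int c * x ^ n"
  by (induction n) (simp_all add: monom_0 monom_Suc mult_ac)

lemma CHAR_poly: "CHAR('b::comm_ring_1 poly) = CHAR('b)"
  by (rule CHAR_eqI) (auto simp: of_nat_poly of_nat_eq_0_iff_char_dvd)

section \<open>The cyclotomic polynomial of prime index\<close>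

definition cyc_poly :: "nat \<Rightarrow> int poly" where
  "cyc_poly p = (\<Sum>k<p. monom 1 k)"

lemma ipoly_cyc_poly: "(x - 1) * ipoly (cyc_poly p) x = x ^ p - 1"
  by (simp add: cyc_poly_def power_diff_1_eq)

lemma degree_cyc_poly: "p > 0 \<Longrightarrow> degree (cyc_poly p) = p - 1"
  and lead_coeff_cyc_poly: "p > 0 \<Longrightarrow> lead_coeff (cyc_poly p) = 1"
proof -
  assume p: "p > 0"
  have c: "coeff (cyc_poly p) k = (if k < p then 1 else 0)" for k
    by (simp add: cyc_poly_def coeff_sum)
  show *: "degree (cyc_poly p) = p - 1"
    using p by (intro antisym degree_le le_degree) (auto simp: c)
  show "lead_coeff (cyc_poly p) = 1" unfolding * c using p by simp
qed

text \<open>Modulo \<open>p\<close>, multiplying by \<open>X - 1\<close> gives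
  \<open>X ^ p - 1 = (X - 1) ^ p\<close>; one factor is cancelled.\<close>

lemma cyc_poly_mod_char:
  assumes p: "p = CHAR('b::field)" "prime p"
  shows "(map_poly of_int (cyc_poly p) :: 'b poly) = [:- 1, 1:] ^ (p - 1)"
proof -
  have p0: "p > 0" using p(2) prime_gt_0_nat by blast
  have "[:- 1, 1:] * (map_poly of_int (cyc_poly p) :: 'b poly) = monom 1 p - 1"
  proof -
    have "[:- 1, 1:] * cyc_poly p = monom 1 p - 1"
    proof -
      have "(monom 1 1 - 1) * (\<Sum>k<p. monom 1 1 ^ k) = (monom 1 1 ^ p - 1 :: int poly)"
        by (simp add: power_diff_1_eq)
      moreover have "monom 1 1 - 1 = ([:- 1, 1:] :: int poly)" by (simp add: monom_altdef one_pCons)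
      moreover have "monom 1 1 ^ k = (monom 1 k :: int poly)" for k by (simp add: monom_power)
      ultimately show ?thesis by (simp only: cyc_poly_def)
    qed
    then have "map_poly of_int ([:- 1, 1:] * cyc_poly p) = (map_poly of_int (monom 1 p + (- 1)) :: 'b poly)"
      by simp
    then show ?thesis unfolding map_poly_of_int_mult map_poly_of_int_add
      by (simp add: map_poly_pCons map_poly_monom one_pCons del: mult_pCons_left)
  qed
  also have "\<dots> = [:- 1, 1:] ^ p"
  proof -
    have "prime CHAR('b poly)" using p by (simp add: CHAR_poly)
    then have "(monom 1 1 + [:- 1:] :: 'b poly) ^ p = monom 1 1 ^ p + [:- 1:] ^ p"
      using p by (intro freshmans_dream) (simp_all add: CHAR_poly)
    moreover have "(- 1 :: 'b) ^ p = - 1" using minus_power_prime_CHAR[OF p, of 1] by simp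
    moreover have "monom 1 1 + [:- 1:] = ([:- 1, 1:] :: 'b poly)" by (simp add: monom_altdef)
    ultimately have "[:- 1, 1:] ^ p = monom 1 p + ([:- 1:] :: 'b poly)"
      by (simp add: monom_power poly_const_pow)
    then show ?thesis by (simp add: one_pCons)
  qed
  also have "\<dots> = [:- 1, 1:] * [:- 1, 1:] ^ (p - 1)"
    using p0 by (simp del: mult_pCons_left flip: power_Suc)
  finally show ?thesis by (simp del: mult_pCons_left)
qed

text \<open>Modulo \<open>p\<close> both factors are powers of \<open>X - 1\<close> up to units, so
  if neither is constant, \<open>p\<close> divides both values at 1. Their product would be
  divisible by \<open>p * p\<close>, but the cyclotomic polynomial has value \<open>p\<close> at
  1.\<close>

lemma cyc_poly_irreducible:
  assumes p: "p = CHAR('b::field)" "prime p" and fg: "cyc_poly p = f * g"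
  shows "degree f = 0 \<or> degree g = 0"
proof (rule ccontr)
  assume *: "\<not> ?thesis"
  have p0: "p > 0" using p(2) prime_gt_0_nat by blast
  have lc: "lead_coeff f * lead_coeff g = 1"
    using lead_coeff_cyc_poly[OF p0] by (simp add: fg lead_coeff_mult)
  \<comment> \<open>The leading coefficients are units, so no degree drops under reduction modulo
    \<open>p\<close>.\<close>
  have deg: "degree (map_poly of_int h :: 'b poly) = degree h" if "lead_coeff h dvd 1" for h :: "int poly"
  proof (rule antisym)
    show "degree (map_poly of_int h :: 'b poly) \<le> degree h"
      by (rule degree_le) (simp add: coeff_map_poly coeff_eq_0)
    have "(of_int (lead_coeff h) :: 'b) \<noteq> 0"
      using that by (auto simp: abs_if split: if_splits)
    then show "degree h \<le> degree (map_poly of_int h :: 'b poly)"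
      by (intro le_degree) (simp add: coeff_map_poly)
  qed
  let ?f = "map_poly of_int f :: 'b poly" and ?g = "map_poly of_int g :: 'b poly"
  have degs: "degree ?f = degree f" "degree ?g = degree g"
    using deg[of f] deg[of g] lc by (metis dvd_triv_left dvd_triv_right)+
  have prod: "?f * ?g = [:- 1, 1:] ^ (p - 1)"
    using cyc_poly_mod_char[OF p] by (simp add: fg map_poly_of_int_mult)
  then have nz: "?f * ?g \<noteq> 0" by (simp del: mult_pCons_left)
  \<comment> \<open>The orders of vanishing at 1 already add up to the total degree, so each equals
    the degree of its factor.\<close>
  have "p - 1 = order 1 ?f + order 1 ?g"
    using order_mult[OF nz, of 1] order_power_n_n[of "1 :: 'b" "p - 1"] by (simp add: prod)
  moreover have "p - 1 = degree ?f + degree ?g"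
  proof -
    have "f \<noteq> 0" "g \<noteq> 0" using lc by auto
    then show ?thesis using degree_cyc_poly[OF p0] by (simp add: fg degs degree_mult_eq)
  qed
  moreover have "order 1 ?f \<le> degree ?f" "order 1 ?g \<le> degree ?g"
    using nz by (auto intro!: order_degree)
  ultimately have "order 1 ?f = degree ?f" "order 1 ?g = degree ?g" by linarith+
  then have "poly ?f 1 = 0" "poly ?g 1 = 0" using * degs by (metis order_root)+
  then have "ipoly f (1 :: 'b) = 0" "ipoly g (1 :: 'b) = 0" by (simp_all add: ipoly_def)
  moreover have "ipoly h (1 :: 'b) = of_int (ipoly h 1)" for h :: "int poly"
    by (induction h) auto
  ultimately have "int p dvd ipoly f 1" "int p dvd ipoly g (1 :: int)"
    by (simp_all add: of_int_eq_0_iff_char_dvd p)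
  then have "int p * int p dvd ipoly (f * g) 1" by (simp add: mult_dvd_mono)
  also have "ipoly (f * g) 1 = int p" by (simp add: cyc_poly_def flip: fg)
  finally have "p * p dvd p" by (metis int_dvd_int_iff of_nat_mult)
  then have "p * p \<le> p" using p0 by (rule dvd_imp_le)
  then show False using prime_gt_1_nat[OF p(2)] by simp
qed

text \<open>A primitive integer polynomial \<open>m\<close> of least degree vanishing at
  \<open>z\<close> divides every integer polynomial vanishing at \<open>z\<close>. By irreducibility
  it is the cyclotomic polynomial up to a constant, so it vanishes at \<open>w\<close> as
  well.\<close>

theorem cyc_poly_conjugate:
  fixes z w :: complex
  assumes p: "p = CHAR('b::field)" "prime p"
    and z: "z ^ p = 1" "z \<noteq> 1" and w: "w ^ p = 1" "w \<noteq> 1" and F: "ipoly F z = 0"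
  shows "ipoly F w = 0"
proof -
  have p0: "p > 0" using p(2) prime_gt_0_nat by blast
  have root: "ipoly (cyc_poly p) x = 0" if "x ^ p = 1" "x \<noteq> 1" for x :: complex
    using ipoly_cyc_poly[of x p] that by simp
  have cyc0: "cyc_poly p \<noteq> 0" using lead_coeff_cyc_poly[OF p0] by auto
  define P where "P f \<longleftrightarrow> f \<noteq> 0 \<and> ipoly f z = 0" for f
  have "P (cyc_poly p)" using cyc0 root z by (simp add: P_def)
  then obtain m0 where m0: "P m0" and min: "\<And>f. P f \<Longrightarrow> degree m0 \<le> degree f"
    using ex_has_least_nat[of P "cyc_poly p" degree] by blast
  define m where "m = primitive_part m0"
  have m0_eq: "m0 = smult (content m0) m" by (simp add: m_def)
  have m_nz: "m \<noteq> 0" and cont: "content m = 1" using m0 by (auto simp: P_def m_def)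
  have "of_int (content m0) * ipoly m z = 0" using m0 m0_eq by (metis P_def ipoly_smult)
  then have mz: "ipoly m z = 0" using m0 by (simp add: P_def)
  have degm: "degree m = degree m0" by (simp add: m_def)
  have dvd: "m dvd f" if f: "ipoly f z = 0" for f
  proof -
    \<comment> \<open>Pseudo-division avoids inverting the leading coefficient; minimality kills the
      remainder, and Gauss's lemma for the primitive \<open>m\<close> removes the factor
      \<open>c\<close>.\<close>
    obtain q r where qr: "pseudo_divmod f m = (q, r)" by (cases "pseudo_divmod f m") auto
    define c where "c = coeff m (degree m) ^ (Suc (degree f) - degree m)"
    have eq: "smult c f = m * q + r" and r: "r = 0 \<or> degree r < degree m"
      using pseudo_divmod[OF m_nz qr] by (simp_all add: c_def)
    have "c \<noteq> 0" using m_nz by (simp add: c_def)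
    have "ipoly r z = 0" using arg_cong[OF eq, of "\<lambda>f. ipoly f z"] by (simp add: f mz)
    then have "r = 0" using r min[of r] degm unfolding P_def by linarith
    then have "fract_poly (smult c f) = fract_poly m * fract_poly q" by (simp add: eq del: fract_poly_smult)
    then have "fract_poly m dvd smult (to_fract c) (fract_poly f)" by simp
    then have "fract_poly m dvd fract_poly f"
      using \<open>c \<noteq> 0\<close> by (simp add: dvd_smult_iff)
    then show "m dvd f" by (rule fract_poly_dvdD[OF _ cont])
  qed
  obtain g where g: "cyc_poly p = m * g" using dvd root z by blast
  have "degree m \<noteq> 0"
  proof
    assume "degree m = 0"
    then obtain a where "m = [:a:]" by (rule degree_eq_zeroE)
    then show False using mz m_nz by simp
  qed
  then have "degree g = 0" using cyc_poly_irreducible[OF p g] by simp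
  then obtain a where a: "g = [:a:]" by (rule degree_eq_zeroE)
  have "ipoly m w * of_int a = 0" using root[OF w] by (simp add: g a mult.commute)
  moreover have "a \<noteq> 0" using cyc0 by (auto simp: g a)
  ultimately have "ipoly m w = 0" by simp
  then show ?thesis using dvd[OF F] by (auto elim!: dvdE)
qed

section \<open>Davenport-Hasse for finite fields\<close>

lemma of_nat_fixed_field: "of_nat k \<in> (fixed_field f :: 'a::{finite,field} set)"
  by (induction k) (use fixed_field_simps[OF refl prime_CHAR_finite[where ?'a = 'a], where f = f] in auto)

lemma trace_char_of_nat_mult:
  assumes "x \<in> (fixed_field f :: 'a::{finite,field} set)"
  shows "trace_char f (of_nat c * x) = trace_char f x ^ c"
proof (induction c)
  case 0
  then show ?case by (simp add: trace_char_0[OF refl prime_CHAR_finite[where ?'a = 'a]])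
next
  case (Suc c)
  have "of_nat c * x \<in> fixed_field f"
    using fixed_field_simps(4)[OF refl prime_CHAR_finite of_nat_fixed_field assms] .
  then show ?case
    using trace_char_add[OF refl prime_CHAR_finite assms] Suc by (simp add: ring_distribs)
qed

text \<open>Multiplying the arguments by \<open>c\<close> replaces the \<open>p\<close>-th root of
  unity \<open>z\<close> by its conjugate \<open>z ^ c\<close>, which does not move a rational
  integer.\<close>

lemma sum_trace_char_conjugate:
  assumes h: "\<And>x. x \<in> A \<Longrightarrow> h x \<in> (fixed_field f :: 'a::{finite,field} set)"
    and c: "\<not> CHAR('a) dvd c" and sum: "(\<Sum>x\<in>A. trace_char f (h x)) = of_int w"
  shows "(\<Sum>x\<in>A. trace_char f (of_nat c * h x)) = of_int w"
proof -
  let ?p = "CHAR('a)"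
  note p = refl prime_CHAR_finite[where ?'a = 'a]
  define z where "z = cis (2 * pi / real ?p)"
  have zk: "prime_char (of_nat k :: 'a) = z ^ k" for k
    using prime_char_of_nat[OF p, of k] unfolding z_def Complex.DeMoivre by (simp add: mult_ac)
  have "\<forall>x\<in>A. \<exists>k. trace_char f (h x) = z ^ k"
  proof
    fix x assume "x \<in> A"
    then have "ff_trace f (h x) \<in> prime_field" using h ff_trace_in_prime_field[OF p] by blast
    then obtain k where "ff_trace f (h x) = of_nat k" unfolding prime_field_eq[OF p] by (rule imageE)
    then show "\<exists>k. trace_char f (h x) = z ^ k" by (auto simp: trace_char_def zk)
  qed
  then obtain k where k: "\<And>x. x \<in> A \<Longrightarrow> trace_char f (h x) = z ^ k x" by metis
  \<comment> \<open>The hypothesis says that this integer polynomial vanishes at \<open>z\<close>;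
    the claim is that it vanishes at \<open>z ^ c\<close>.\<close>
  define F where "F = (\<Sum>x\<in>A. monom 1 (k x)) - [:w:]"
  have F: "ipoly F v = (\<Sum>x\<in>A. v ^ k x) - of_int w" for v :: complex
    by (simp add: F_def)
  have zp: "z ^ ?p = 1" using zk[of ?p] zk[of 0] by simp
  have root: "z ^ j \<noteq> 1" if "\<not> ?p dvd j" for j
  proof -
    have "(of_nat j :: 'a) \<in> prime_field"
    proof -
      have "of_nat j ^ ?p = (of_nat j :: 'a)"
        using of_nat_fixed_field[of j 1, where ?'a = 'a] by (simp add: fixed_field_def)
      then show ?thesis by (simp add: prime_field_def)
    qed
    then show ?thesis using prime_char_eq_1_iff[OF p, of "of_nat j"] that
      by (simp add: zk of_nat_eq_0_iff_char_dvd)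
  qed
  have "ipoly F z = 0" unfolding F using sum by (simp add: k cong: sum.cong)
  moreover have "z \<noteq> 1" using root[of 1] prime_gt_1_nat[OF p(2)] by simp
  moreover have "(z ^ c) ^ ?p = 1" using zp by (metis mult.commute power_mult power_one)
  ultimately have "ipoly F (z ^ c) = 0"
    using cyc_poly_conjugate[OF p zp _ _ root[OF c]] by blast
  then have "(\<Sum>x\<in>A. (z ^ c) ^ k x) = of_int w" unfolding F by simp
  moreover have "trace_char f (of_nat c * h x) = (z ^ c) ^ k x" if "x \<in> A" for x
    using trace_char_of_nat_mult[OF h[OF that]] k[OF that] by (simp add: mult.commute flip: power_mult)
  ultimately show ?thesis by (simp cong: sum.cong)
qed

section \<open>Relative norms between finite fields\<close>

definition rel_norm :: "nat \<Rightarrow> nat \<Rightarrow> 'b::field \<Rightarrow> 'b" where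
  "rel_norm f m x = (\<Prod>i<m. x ^ ((CHAR('b) ^ f) ^ i))"

lemma rel_norm_mult: "rel_norm f m (x * y) = rel_norm f m x * rel_norm f m y"
  by (simp add: rel_norm_def power_mult_distrib prod.distrib)

lemma rel_norm_1 [simp]: "rel_norm f m 1 = 1"
  by (simp add: rel_norm_def)

lemma rel_norm_power: "rel_norm f m (x ^ k) = rel_norm f m x ^ k"
  by (induction k) (simp_all add: rel_norm_mult)

lemma rel_norm_eq_0_iff: "m > 0 \<Longrightarrow> CHAR('b) > 0 \<Longrightarrow> rel_norm f m (x :: 'b::field) = 0 \<longleftrightarrow> x = 0"
  by (auto simp: rel_norm_def)

lemma CARD_power_eq_self: "(x :: 'a::{finite,field}) ^ CARD('a) = x"
proof -
  have "x \<in> fixed_field (fdeg TYPE('a))" by (simp add: fixed_field_fdeg)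
  then show ?thesis by (simp add: fixed_field_def CARD_eq_CHAR_power)
qed

text \<open>Frobenius of the subfield permutes the factors cyclically.\<close>

lemma rel_norm_in_fixed_field:
  fixes x :: "'a::{finite,field}"
  assumes n: "fdeg TYPE('a) = f * m" and m: "m > 0"
  shows "rel_norm f m x \<in> fixed_field f"
proof (cases "x = 0")
  case True
  have "CHAR('a) > 0" using prime_gt_0_nat[OF prime_CHAR_finite] .
  then have "rel_norm f m x = 0" using rel_norm_eq_0_iff[OF m] True by blast
  then show ?thesis using fixed_field_simps(1)[OF refl prime_CHAR_finite] by simp
next
  case False
  let ?Q = "CHAR('a) ^ f"
  have xq: "x ^ (?Q ^ m) = x"
    using CARD_power_eq_self[of x] by (simp add: CARD_eq_CHAR_power n power_mult)
  have "rel_norm f m x ^ ?Q = (\<Prod>i<m. x ^ (?Q ^ Suc i))"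
    unfolding rel_norm_def prod_power_distrib power_mult[symmetric] power_Suc2 by (rule refl)
  then have "x * rel_norm f m x ^ ?Q = (\<Prod>i<Suc m. x ^ (?Q ^ i))"
    by (subst prod.lessThan_Suc_shift) simp
  also have "\<dots> = x * rel_norm f m x"
    unfolding prod.lessThan_Suc xq by (simp add: rel_norm_def)
  finally show ?thesis using False by (simp add: fixed_field_def)
qed

text \<open>The norm is the power map with exponent \<open>e = (q - 1) / (Q - 1)\<close>. If
  \<open>y = g ^ i\<close> is killed by \<open>Q - 1\<close>, then \<open>e\<close> divides
  \<open>i\<close>.\<close>

lemma rel_norm_surj:
  assumes n: "fdeg TYPE('a::{finite,field}) = f * m" and f: "f > 0" and m: "m > 0"
    and y: "y \<in> fixed_field f" "y \<noteq> (0 :: 'a)"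
  shows "\<exists>x. x \<noteq> 0 \<and> rel_norm f m x = y"
proof -
  let ?Q = "CHAR('a) ^ f" and ?q = "CARD('a)"
  have p1: "CHAR('a) > 1" using prime_gt_1_nat[OF prime_CHAR_finite] .
  then have Q1: "?Q > 1" using f by (rule one_less_power)
  define e where "e = (\<Sum>i<m. ?Q ^ i)"
  have norm: "rel_norm f m x = x ^ e" for x :: 'a by (simp add: rel_norm_def e_def power_sum)
  have "int (e * (?Q - 1)) = int (?q - 1)"
  proof -
    have "(int ?Q - 1) * (\<Sum>i<m. int ?Q ^ i) = int ?Q ^ m - 1" by (simp only: power_diff_1_eq)
    moreover have "int (?Q - 1) = int ?Q - 1" using Q1 by linarith
    moreover have "int (?q - 1) = int ?Q ^ m - 1"
      using Q1 by (simp add: CARD_eq_CHAR_power n power_mult of_nat_diff)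
    moreover have "int e = (\<Sum>i<m. int ?Q ^ i)" by (simp add: e_def)
    ultimately show ?thesis by (simp only: of_nat_mult mult.commute)
  qed
  then have e: "?q - 1 = e * (?Q - 1)" by linarith
  obtain g :: 'a where g0: "g \<noteq> 0"
    and bij: "bij_betw (\<lambda>k. g ^ k) {..<CHAR('a) ^ fdeg TYPE('a) - 1} (fixed_field (fdeg TYPE('a)) - {0})"
    and gmod: "\<And>i j. g ^ i = g ^ j \<longleftrightarrow> i mod (CHAR('a) ^ fdeg TYPE('a) - 1) = j mod (CHAR('a) ^ fdeg TYPE('a) - 1)"
    by (rule fixed_field_generator[OF dvd_refl fdeg_pos]) (rule that)
  have gmod': "g ^ i = g ^ j \<longleftrightarrow> i mod (?q - 1) = j mod (?q - 1)" for i j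
    unfolding CARD_eq_CHAR_power by (rule gmod)
  have "y \<in> fixed_field (fdeg TYPE('a)) - {0}" using y(2) by (simp add: fixed_field_fdeg)
  then obtain i where i: "y = g ^ i" using bij_betw_imp_surj_on[OF bij] by blast
  have "Suc (?Q - 1) = ?Q" using Q1 by simp
  then have "y * y ^ (?Q - 1) = y ^ ?Q" by (metis power_Suc)
  also have "\<dots> = y" using y(1) by (simp add: fixed_field_def)
  finally have "y ^ (?Q - 1) = 1" using y(2) by simp
  then have "g ^ (i * (?Q - 1)) = g ^ 0" by (simp add: i power_mult)
  then have "(i * (?Q - 1)) mod (e * (?Q - 1)) = 0" by (simp only: gmod' e mod_0)
  then have "e * (?Q - 1) dvd i * (?Q - 1)" by (rule mod_0_imp_dvd)
  then have "e dvd i" using Q1 by simp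
  then obtain j where "i = e * j" by (rule dvdE)
  then have "rel_norm f m (g ^ j) = y" by (simp add: norm i mult.commute flip: power_mult)
  then show ?thesis using g0 by (intro exI[of _ "g ^ j"]) simp
qed

section \<open>Embedding into the algebraic closure\<close>

lemma prime_char_to_ac: "prime_char (to_ac x) = prime_char (x :: 'b::field)"
proof -
  have "of_nat k = to_ac x \<longleftrightarrow> of_nat k = x" for k by (metis to_ac_eq_iff to_ac_of_nat)
  then show ?thesis by (simp add: prime_char_def)
qed

lemma trace_char_to_ac: "trace_char f (to_ac x) = trace_char f (x :: 'b::field)"
proof -
  have "ff_trace f (to_ac x) = to_ac (ff_trace f x)"
    by (simp add: ff_trace_def to_ac_sum)
  then show ?thesis by (simp add: trace_char_def prime_char_to_ac)
qed

text \<open>The image already has \<open>Q\<close> elements, and \<open>X ^ Q - X\<close> has no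
  more roots than that.\<close>

lemma fixed_field_alg_closure:
  assumes "f dvd fdeg TYPE('a::{finite,field})" "f > 0"
  shows "(fixed_field f :: 'a alg_closure set) = to_ac ` fixed_field f"
proof (rule sym, rule card_subset_eq)
  let ?Q = "CHAR('a) ^ f"
  have p1: "CHAR('a) > 1" using prime_gt_1_nat[OF prime_CHAR_finite] .
  then have Q1: "?Q > 1" using assms(2) by (rule one_less_power)
  define g :: "'a alg_closure poly" where "g = monom 1 ?Q - monom 1 1"
  have "coeff g ?Q = 1" using Q1 by (simp add: g_def)
  then have g: "g \<noteq> 0" by auto
  have roots: "fixed_field f = {x. poly g x = 0}"
    by (auto simp: fixed_field_def g_def poly_monom)
  show fin: "finite (fixed_field f :: 'a alg_closure set)" unfolding roots by (rule poly_roots_finite[OF g])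
  show sub: "to_ac ` fixed_field f \<subseteq> (fixed_field f :: 'a alg_closure set)"
    by (auto simp: fixed_field_def simp flip: to_ac_power)
  have c: "card (to_ac ` (fixed_field f :: 'a set)) = ?Q"
    using card_fixed_field[OF assms] by (simp add: card_image inj_on_subset[OF inj_to_ac])
  have "degree g \<le> ?Q" unfolding g_def
    by (rule degree_diff_le) (use Q1 in \<open>auto intro: order.trans[OF degree_monom_le]\<close>)
  then have "card (fixed_field f :: 'a alg_closure set) \<le> ?Q"
    unfolding roots using card_poly_roots_bound[OF g] by linarith
  then show "card (to_ac ` (fixed_field f :: 'a set)) = card (fixed_field f :: 'a alg_closure set)"
    using card_mono[OF fin sub] c by linarith
qed

theorem davenport_hasse_finite:
  fixes \<kappa> :: "'a::{finite,field} \<Rightarrow> complex"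
  assumes n: "fdeg TYPE('a) = f * m" and f: "f > 0" and m: "m > 0"
    and mult: "\<And>x y. x \<in> fixed_field f \<Longrightarrow> y \<in> fixed_field f \<Longrightarrow> \<kappa> (x * y) = \<kappa> x * \<kappa> y"
    and k1: "\<kappa> 1 = 1"
  shows "(\<Sum>x\<in>UNIV. trace_char (f * m) x * \<kappa> (rel_norm f m x))
    = (- 1) ^ (m - 1) * (\<Sum>x\<in>fixed_field f. trace_char f x * \<kappa> x) ^ m"
proof -
  let ?Q = "CHAR('a) ^ f"
  have dvd: "f dvd fdeg TYPE('a)" by (simp add: n)
  note pr = prime_CHAR_finite[where ?'a = 'a]
  have pr': "prime CHAR('a alg_closure)" using pr by simp
  note P' = refl pr'
  have fixed: "x ^ ?Q = x \<longleftrightarrow> x \<in> to_ac ` fixed_field f" for x :: "'a alg_closure"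
    using fixed_field_alg_closure[OF dvd f] by (auto simp: fixed_field_def)
  interpret dh: davenport_hasse ?Q "trace_char f :: 'a alg_closure \<Rightarrow> complex" "\<lambda>x. \<kappa> (of_ac x)"
  proof
    show "?Q > 1" using prime_gt_1_nat[OF pr] f by (rule one_less_power)
    show "(x + y) ^ ?Q = x ^ ?Q + y ^ ?Q" for x y :: "'a alg_closure"
      using frob_pow_add[OF P', of x y f] by simp
    show "trace_char f (x + y) = trace_char f x * trace_char f y"
      if "x ^ ?Q = x" "y ^ ?Q = y" for x y :: "'a alg_closure"
      using trace_char_add[OF P', of x f y] that by (simp add: fixed_field_def)
    obtain c :: 'a where "c \<in> fixed_field f" "trace_char f c \<noteq> 1"
      using trace_char_nontrivial[OF refl pr card_fixed_field[OF dvd f] f] by blast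
    then show "\<exists>c :: 'a alg_closure. c ^ ?Q = c \<and> trace_char f c \<noteq> 1"
      unfolding fixed by (intro exI[of _ "to_ac c"]) (simp add: trace_char_to_ac)
    show "trace_char f (0 :: 'a alg_closure) = 1" by (rule trace_char_0[OF P'])
    show "\<kappa> (of_ac (x * y)) = \<kappa> (of_ac x) * \<kappa> (of_ac y)" if xy: "x ^ ?Q = x" "y ^ ?Q = y" for x y
    proof -
      obtain x' y' where "x = to_ac x'" "y = to_ac y'" "x' \<in> fixed_field f" "y' \<in> fixed_field f"
        using xy unfolding fixed by (elim imageE)
      then show ?thesis using mult[of x' y'] by (simp flip: to_ac_mult)
    qed
    show "\<kappa> (of_ac 1) = 1" by (simp add: k1)
  qed
  \<comment> \<open>The fixed points of the \<open>m\<close>-th iterate of Frobenius are exactly the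
    embedded finite field, so the sum over them pulls back to the type \<open>'a\<close>.\<close>
  have "{x :: 'a alg_closure. x ^ (?Q ^ m) = x} = fixed_field (f * m)"
    by (simp add: fixed_field_def power_mult)
  also have "\<dots> = range to_ac"
    using fixed_field_alg_closure[OF dvd_refl fdeg_pos, where ?'a = 'a]
    by (simp add: fixed_field_fdeg flip: n)
  finally have all: "{x :: 'a alg_closure. x ^ (?Q ^ m) = x} = range to_ac" .
  have L: "(\<Sum>x | x ^ (?Q ^ m) = x. trace_char f (\<Sum>i<m. x ^ (?Q ^ i)) * \<kappa> (of_ac (\<Prod>i<m. x ^ (?Q ^ i))))
      = (\<Sum>x\<in>UNIV. trace_char (f * m) x * \<kappa> (rel_norm f m x))"
  proof -
    have "trace_char f (\<Sum>i<m. to_ac x ^ (?Q ^ i)) = trace_char (f * m) x" for x :: 'a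
    proof -
      have "(\<Sum>i<m. to_ac x ^ (?Q ^ i)) = to_ac (\<Sum>i<m. x ^ (?Q ^ i))" by (simp add: to_ac_sum)
      then show ?thesis using trace_char_trans[OF refl pr, of f m x] by (simp only: trace_char_to_ac)
    qed
    moreover have "of_ac (\<Prod>i<m. to_ac x ^ (?Q ^ i)) = rel_norm f m x" for x :: 'a
      unfolding rel_norm_def by (simp flip: to_ac_power to_ac_prod)
    ultimately show ?thesis unfolding all by (simp add: sum.reindex inj_to_ac)
  qed
  have R: "(\<Sum>x | x ^ ?Q = x. trace_char f x * \<kappa> (of_ac x)) = (\<Sum>x\<in>fixed_field f. trace_char f x * \<kappa> x)"
    unfolding fixed by (simp add: sum.reindex inj_on_subset[OF inj_to_ac] trace_char_to_ac)
  show ?thesis using dh.davenport_hasse[OF m] unfolding L R .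
qed

section \<open>Comparing Weil sums along a field extension\<close>

text \<open>Reduction modulo \<open>X ^ N - 1\<close>.\<close>

definition fold_poly :: "nat \<Rightarrow> int poly \<Rightarrow> int poly" where
  "fold_poly N f = (\<Sum>i\<le>degree f. monom (coeff f i) (i mod N))"

lemma ipoly_fold_poly:
  assumes "x ^ N = 1"
  shows "ipoly (fold_poly N f) x = ipoly f x"
proof -
  have "x ^ (i mod N) = x ^ i" for i
  proof -
    have "x ^ i = (x ^ N) ^ (i div N) * x ^ (i mod N)"
      by (simp flip: power_mult power_add)
    then show ?thesis by (simp add: assms)
  qed
  then have "ipoly (fold_poly N f) x = (\<Sum>i\<le>degree f. ipoly (monom (coeff f i) i) x)"
    by (simp add: fold_poly_def)
  also have "\<dots> = ipoly f x"
    by (simp only: ipoly_sum[symmetric] poly_as_sum_of_monoms)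
  finally show ?thesis .
qed

text \<open>The reduction of \<open>f\<close> modulo \<open>X ^ N - 1\<close> has degree below
  \<open>N\<close> but \<open>N\<close> complex roots, so it is zero. Hence \<open>f\<close>
  vanishes wherever \<open>x ^ N = 1\<close>, in any commutative ring.\<close>

lemma ipoly_eq_0_if_roots_of_unity:
  fixes x :: "'b::comm_ring_1"
  assumes N: "N > 0" and roots: "\<And>z :: complex. z ^ N = 1 \<Longrightarrow> ipoly f z = 0" and x: "x ^ N = 1"
  shows "ipoly f x = 0"
proof -
  define g where "g = fold_poly N f"
  have "degree g \<le> N - 1" unfolding g_def fold_poly_def
  proof (rule degree_sum_le)
    fix i
    have "i mod N \<le> N - 1" using N mod_less_divisor[of N i] by linarith
    then show "degree (monom (coeff f i) (i mod N)) \<le> N - 1" using degree_monom_le order.trans by blast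
  qed simp
  then have deg: "degree g < N" using N by linarith
  have "(map_poly of_int g :: complex poly) = 0"
  proof (rule ccontr)
    assume nz: "(map_poly of_int g :: complex poly) \<noteq> 0"
    have "{z. z ^ N = 1} \<subseteq> {z :: complex. poly (map_poly of_int g) z = 0}"
      using roots ipoly_fold_poly[of "_ :: complex" N f] by (auto simp: ipoly_def g_def)
    then have "N \<le> card {z :: complex. poly (map_poly of_int g) z = 0}"
      using card_mono[OF poly_roots_finite[OF nz]] card_roots_unity_eq[OF N] by metis
    also have "\<dots> \<le> degree (map_poly of_int g :: complex poly)" by (rule card_poly_roots_bound[OF nz])
    also have "\<dots> \<le> degree g" by (rule degree_le) (simp add: coeff_map_poly coeff_eq_0)
    finally show False using deg by simp
  qed
  then have "g = 0" by (simp add: map_poly_eq_0_iff)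
  then show ?thesis using ipoly_fold_poly[OF x, of f] by (simp add: g_def)
qed

lemma field_character_UNIV:
  "field_character (UNIV :: 'a::{finite,field} set) (trace_char (fdeg TYPE('a)))"
  using field_character_fixed_field[OF dvd_refl fdeg_pos, where ?'a = 'a] by (simp only: fixed_field_fdeg)

lemma bij_betw_power_fixed_field:
  assumes bij: "bij (\<lambda>x :: 'a::{finite,field}. x ^ D)"
  shows "bij_betw (\<lambda>x. x ^ D) (fixed_field f :: 'a set) (fixed_field f)"
proof -
  have "inj_on (\<lambda>x. x ^ D) (fixed_field f :: 'a set)"
    using bij by (meson bij_is_inj inj_on_subset subset_UNIV)
  moreover have "(\<lambda>x. x ^ D) ` (fixed_field f :: 'a set) \<subseteq> fixed_field f"
    using fixed_field_simps(6)[OF refl prime_CHAR_finite[where ?'a = 'a]] by blast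
  ultimately show ?thesis using endo_inj_surj[of "fixed_field f :: 'a set"] by (simp add: bij_betw_def)
qed

definition subfield_sum :: "nat \<Rightarrow> nat \<Rightarrow> 'b::field \<Rightarrow> complex" where
  "subfield_sum f D a = (\<Sum>x\<in>fixed_field f. trace_char f (x ^ D + a * x))"

section \<open>Multiplicative characters, and Weil sums of a field and a subfield\<close>

context
  fixes f m D E N :: nat and \<theta> :: "'a::{finite,field}" and dlog :: "'a \<Rightarrow> nat"
  assumes n: "fdeg TYPE('a) = f * m" and f: "f > 0" and m: "m > 0"
    and D: "D > 0" and bijD: "bij (\<lambda>x :: 'a. x ^ D)" and E: "\<And>x :: 'a. (x ^ D) ^ E = x"
    and N: "N > 0" "CHAR('a) ^ f = N + 1"
    and bij: "bij_betw (\<lambda>k. \<theta> ^ k) {..<N} (fixed_field f - {0})"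
    and theta_eq: "\<And>i j. \<theta> ^ i = \<theta> ^ j \<longleftrightarrow> i mod N = j mod N"
    and dlog: "\<And>y. y \<in> fixed_field f \<Longrightarrow> y \<noteq> 0 \<Longrightarrow> \<theta> ^ dlog y = y"
begin

lemma theta_in: "\<theta> ^ k \<in> fixed_field f - {0}"
proof -
  have "\<theta> ^ k = \<theta> ^ (k mod N)" by (simp add: theta_eq)
  moreover have "k mod N \<in> {..<N}" using N by simp
  ultimately show ?thesis using bij_betw_apply[OF bij] by metis
qed

context
  fixes z :: complex
  assumes z: "z ^ N = 1"
begin

text \<open>The multiplicative character of the subfield with value \<open>z\<close> at the
  generator; \<open>z\<close> running through the \<open>N\<close>-th roots of unity gives all of
  them. The value at 0 is 0 even for the trivial character.\<close>

definition dchar :: "'a \<Rightarrow> complex" where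
  "dchar y = (if y = 0 then 0 else z ^ dlog y)"

lemma z_mod: "i mod N = j mod N \<Longrightarrow> z ^ i = z ^ j"
proof -
  have "z ^ i = z ^ (i mod N)" for i
  proof -
    have "z ^ i = (z ^ N) ^ (i div N) * z ^ (i mod N)"
      by (simp flip: power_mult power_add)
    then show ?thesis by (simp add: z)
  qed
  then show "i mod N = j mod N \<Longrightarrow> z ^ i = z ^ j" by metis
qed

lemma dchar_theta: "dchar (\<theta> ^ k) = z ^ k"
proof -
  have "\<theta> ^ dlog (\<theta> ^ k) = \<theta> ^ k" using theta_in[of k] by (intro dlog) auto
  then have "dlog (\<theta> ^ k) mod N = k mod N" by (simp only: theta_eq)
  then have "z ^ dlog (\<theta> ^ k) = z ^ k" by (rule z_mod)
  then show ?thesis using theta_in[of k] by (simp add: dchar_def)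
qed

lemma dchar_0: "dchar 0 = 0" and dchar_1: "dchar 1 = 1"
  using dchar_theta[of 0] by (simp_all add: dchar_def)

lemma dchar_mult:
  assumes "x \<in> fixed_field f" "y \<in> fixed_field f"
  shows "dchar (x * y) = dchar x * dchar y"
proof (cases "x = 0 \<or> y = 0")
  case False
  then obtain i j where "x = \<theta> ^ i" "y = \<theta> ^ j" using dlog assms by metis
  then show ?thesis by (simp add: dchar_theta flip: power_add)
qed (auto simp: dchar_0)

lemma sum_fixed_field: "(\<Sum>x\<in>fixed_field f - {0}. h x) = (\<Sum>k<N. h (\<theta> ^ k))"
  by (rule sum.reindex_bij_betw[OF bij, symmetric])

text \<open>Both Mellin transforms are products of two Gauss sums, and the Davenport-Hasse theorem
  relates the factors one by one. The sign \<open>(-1) ^ (m - 1)\<close> occurs twice and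
  cancels.\<close>

lemma weil_comparison_nontrivial:
  assumes z1: "z \<noteq> 1"
  shows "(\<Sum>a\<in>UNIV. subfield_sum (f * m) D a * dchar (rel_norm f m a))
    = (\<Sum>a\<in>fixed_field f. subfield_sum f D a * dchar a) ^ m"
proof -
  have dvd: "f dvd fdeg TYPE('a)" by (simp add: n)
  interpret L: field_character "fixed_field f :: 'a set" "trace_char f"
    by (rule field_character_fixed_field[OF dvd f])
  have univ: "fixed_field (f * m) = (UNIV :: 'a set)" using fixed_field_fdeg n by metis
  interpret K: field_character "UNIV :: 'a set" "trace_char (f * m)"
    using field_character_UNIV[where ?'a = 'a] by (simp only: n)
  have K_wsum: "K.wsum D a = subfield_sum (f * m) D a" for a
    using K.wsum_def by (simp add: subfield_sum_def univ)
  have L_wsum: "L.wsum D a = subfield_sum f D a" for a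
    using L.wsum_def by (simp add: subfield_sum_def)
  have fin: "finite (fixed_field f :: 'a set)" by (rule L.finite_S)
  have sumL: "(\<Sum>x\<in>fixed_field f. dchar x) = 0"
  proof -
    have "(\<Sum>x\<in>fixed_field f. dchar x) = dchar 0 + (\<Sum>x\<in>fixed_field f - {0}. dchar x)"
      by (rule sum.remove[OF fin L.zero_S])
    also have "\<dots> = (\<Sum>k<N. z ^ k)" by (simp add: sum_fixed_field dchar_theta dchar_0)
    also have "\<dots> = 0" using power_diff_1_eq[of z N] z z1 by simp
    finally show ?thesis .
  qed
  have norm_in: "rel_norm f m x \<in> fixed_field f" for x :: 'a by (rule rel_norm_in_fixed_field[OF n m])
  \<comment> \<open>An element of norm \<open>\<theta>\<close> exists, and rescaling the sum by it
    multiplies the sum by \<open>z\<close>, which is not 1.\<close>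
  have sumK: "(\<Sum>x\<in>UNIV. dchar (rel_norm f m x)) = 0"
  proof -
    have "\<theta> \<in> fixed_field f" "\<theta> \<noteq> 0" using theta_in[of 1] by auto
    then obtain a where a: "a \<noteq> 0" "rel_norm f m a = \<theta>" using rel_norm_surj[OF n f m] by blast
    have "(\<Sum>x\<in>UNIV. dchar (rel_norm f m x)) = (\<Sum>x\<in>UNIV. dchar (rel_norm f m (a * x)))"
      by (rule K.sum_scale[OF _ a(1), symmetric]) simp
    also have "\<dots> = z * (\<Sum>x\<in>UNIV. dchar (rel_norm f m x))"
      using dchar_mult[OF \<open>\<theta> \<in> fixed_field f\<close> norm_in] dchar_theta[of 1]
      by (simp add: rel_norm_mult a sum_distrib_left)
    finally show ?thesis using z1 by simp
  qed
  have norm_0: "rel_norm f m 0 = (0 :: 'a)"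
    using rel_norm_eq_0_iff[OF m] prime_gt_0_nat[OF prime_CHAR_finite[where ?'a = 'a]] by blast
  define \<kappa> where "\<kappa> x = inverse (dchar (x ^ E))" for x
  have kappa_mult: "\<kappa> (x * y) = \<kappa> x * \<kappa> y" if "x \<in> fixed_field f" "y \<in> fixed_field f" for x y
    using that by (simp add: \<kappa>_def power_mult_distrib dchar_mult L.closed)
  have DH: "K.gauss (\<lambda>x. h (rel_norm f m x)) = (- 1) ^ (m - 1) * L.gauss h ^ m"
    if "\<And>x y. x \<in> fixed_field f \<Longrightarrow> y \<in> fixed_field f \<Longrightarrow> h (x * y) = h x * h y" "h 1 = 1" for h
    unfolding K.gauss_def L.gauss_def by (rule davenport_hasse_finite[OF n f m that])
  have bijU: "bij_betw (\<lambda>x :: 'a. x ^ D) UNIV UNIV" using bijD .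
  have "(\<Sum>a\<in>UNIV. subfield_sum (f * m) D a * dchar (rel_norm f m a))
      = K.gauss (\<lambda>x. dchar (rel_norm f m x)) * K.gauss (\<lambda>x. inverse (dchar (rel_norm f m (x ^ E))))"
    unfolding K_wsum[symmetric]
    by (rule K.wsum_mellin[OF D bijU])
      (use sumK norm_0 in \<open>auto simp: rel_norm_mult dchar_mult norm_in dchar_0 dchar_1 E\<close>)
  also have "K.gauss (\<lambda>x. inverse (dchar (rel_norm f m (x ^ E)))) = K.gauss (\<lambda>x. \<kappa> (rel_norm f m x))"
    by (simp add: \<kappa>_def rel_norm_power)
  also have "\<dots> = (- 1) ^ (m - 1) * L.gauss \<kappa> ^ m"
    using kappa_mult by (rule DH) (auto simp: \<kappa>_def dchar_1)
  also have "K.gauss (\<lambda>x. dchar (rel_norm f m x)) = (- 1) ^ (m - 1) * L.gauss dchar ^ m"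
    using dchar_mult dchar_1 by (rule DH)
  finally have "(\<Sum>a\<in>UNIV. subfield_sum (f * m) D a * dchar (rel_norm f m a)) = (L.gauss dchar * L.gauss \<kappa>) ^ m"
    by (simp add: power_mult_distrib mult_ac flip: power_add)
  also have "L.gauss dchar * L.gauss \<kappa> = (\<Sum>a\<in>fixed_field f. subfield_sum f D a * dchar a)"
    unfolding L_wsum[symmetric] \<kappa>_def
    by (rule L.wsum_mellin[OF D bij_betw_power_fixed_field[OF bijD], symmetric])
      (auto simp: dchar_mult dchar_0 dchar_1 sumL E)
  finally show ?thesis .
qed

text \<open>Over all characters this says that summing the large Weil sum along norm fibres yields
  the \<open>m\<close>-fold convolution power of the small one. For \<open>z = 1\<close> the first
  moments decide: both sides are the order of the large field.\<close>

lemma weil_comparison: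
  "(\<Sum>a\<in>UNIV - {0}. subfield_sum (f * m) D a * z ^ dlog (rel_norm f m a))
    = (\<Sum>k<N. subfield_sum f D (\<theta> ^ k) * z ^ k) ^ m"
proof -
  have dvd: "f dvd fdeg TYPE('a)" by (simp add: n)
  interpret L: field_character "fixed_field f :: 'a set" "trace_char f"
    by (rule field_character_fixed_field[OF dvd f])
  have univ: "fixed_field (f * m) = (UNIV :: 'a set)" using fixed_field_fdeg n by metis
  interpret K: field_character "UNIV :: 'a set" "trace_char (f * m)"
    using field_character_UNIV[where ?'a = 'a] by (simp only: n)
  have K_wsum: "K.wsum D a = subfield_sum (f * m) D a" for a
    using K.wsum_def by (simp add: subfield_sum_def univ)
  have L_wsum: "L.wsum D a = subfield_sum f D a" for a
    using L.wsum_def by (simp add: subfield_sum_def)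
  have bijU: "bij_betw (\<lambda>x :: 'a. x ^ D) UNIV UNIV" using bijD .
  note bijL = bij_betw_power_fixed_field[OF bijD, of f]
  have zK: "subfield_sum (f * m) D (0 :: 'a) = 0" using K.wsum_0[OF D bijU] K_wsum by simp
  have zL: "subfield_sum f D (0 :: 'a) = 0" using L.wsum_0[OF D bijL] L_wsum by simp
  have lhs: "(\<Sum>a\<in>UNIV. subfield_sum (f * m) D a * h a) = (\<Sum>a\<in>UNIV - {0}. subfield_sum (f * m) D a * h a)" for h :: "'a \<Rightarrow> complex"
    by (subst sum.remove[of _ 0]) (simp_all add: zK)
  have rhs: "(\<Sum>a\<in>fixed_field f. subfield_sum f D a * h a) = (\<Sum>k<N. subfield_sum f D (\<theta> ^ k) * h (\<theta> ^ k))" for h :: "'a \<Rightarrow> complex"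
    by (subst sum.remove[OF L.finite_S L.zero_S]) (simp add: zL sum_fixed_field)
  show ?thesis
  proof (cases "z = 1")
    case True
    have "(\<Sum>a\<in>UNIV - {0 :: 'a}. subfield_sum (f * m) D a) = of_nat (CARD('a))"
      using lhs[of "\<lambda>_. 1"] K.sum_wsum[OF D bijU] by (simp add: K_wsum)
    moreover have "(\<Sum>k<N. subfield_sum f D (\<theta> ^ k)) = of_nat (card (fixed_field f :: 'a set))"
      using rhs[of "\<lambda>_. 1"] L.sum_wsum[OF D bijL] by (simp add: L_wsum)
    moreover have "CARD('a) = card (fixed_field f :: 'a set) ^ m"
      by (simp add: card_fixed_field[OF dvd f] CARD_eq_CHAR_power n power_mult)
    ultimately show ?thesis using True by simp
  next
    case False
    have "rel_norm f m a \<noteq> 0" if "a \<noteq> 0" for a :: 'a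
      using rel_norm_eq_0_iff[OF m] prime_gt_0_nat[OF prime_CHAR_finite[where ?'a = 'a]] that by blast
    then have "(\<Sum>a\<in>UNIV - {0}. subfield_sum (f * m) D a * z ^ dlog (rel_norm f m a))
      = (\<Sum>a\<in>UNIV - {0}. subfield_sum (f * m) D a * dchar (rel_norm f m a))"
      by (intro sum.cong) (auto simp: dchar_def)
    then show ?thesis using weil_comparison_nontrivial[OF False]
      by (simp add: lhs rhs dchar_theta)
  qed
qed

end

text \<open>Dividing the comparison by \<open>l ^ m\<close> gives \<open>U ^ m = p * c * V\<close>
  at all complex \<open>N\<close>-th roots of unity, with the values \<open>u\<close> as
  coefficients of \<open>U\<close>. The identity transfers to characteristic \<open>p\<close>, where
  the right side disappears.\<close>

lemma weil_divisibility:
  fixes u v :: "'a \<Rightarrow> int" and l P :: int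
  assumes u: "\<And>a. a \<in> fixed_field f \<Longrightarrow> subfield_sum f D a = of_int (l * u a)"
    and v: "\<And>a :: 'a. a \<noteq> 0 \<Longrightarrow> subfield_sum (f * m) D a = of_int (P * v a)"
    and l: "l \<noteq> 0" and P: "l ^ m * int CHAR('a) dvd P"
    and a: "a \<in> fixed_field f" "a \<noteq> 0"
  shows "int CHAR('a) dvd u a"
proof -
  obtain c where "P = l ^ m * int CHAR('a) * c" using P by (rule dvdE)
  then have c: "P = l ^ m * (int CHAR('a) * c)" by (simp only: mult.assoc)
  define U where "U = (\<Sum>k<N. monom (u (\<theta> ^ k)) k)"
  define V where "V = (\<Sum>a\<in>UNIV - {0}. monom (v a) (dlog (rel_norm f m a)))"
  define R where "R = U ^ m - smult (int CHAR('a) * c) V"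
  have "ipoly R z = 0" if z: "z ^ N = 1" for z :: complex
  proof -
    have "(\<Sum>a\<in>UNIV - {0}. subfield_sum (f * m) D a * z ^ dlog (rel_norm f m a)) = of_int P * ipoly V z"
      by (simp add: V_def v sum_distrib_left mult_ac)
    moreover have "(\<Sum>k<N. subfield_sum f D (\<theta> ^ k) * z ^ k) = of_int l * ipoly U z"
      using theta_in by (simp add: U_def u sum_distrib_left mult_ac)
    ultimately have "of_int P * ipoly V z = (of_int l * ipoly U z) ^ m"
      using weil_comparison[OF z] by simp
    then have "of_int (l ^ m) * ipoly R z = 0"
      by (auto simp: R_def c power_mult_distrib algebra_simps)
    then show ?thesis using l by simp
  qed
  \<comment> \<open>The \<open>N\<close>-th roots of unity of the finite field take over from the
    complex ones.\<close>
  then have R0: "ipoly R x = 0" if "x ^ N = 1" for x :: 'a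
    using ipoly_eq_0_if_roots_of_unity[OF N(1) _ that] by blast
  have U0: "ipoly U (\<theta> ^ k) = 0" for k
  proof -
    have "(\<theta> ^ k) ^ N = \<theta> ^ 0" by (simp only: theta_eq power_mult[symmetric]) simp
    then have "ipoly R (\<theta> ^ k) = 0" by (intro R0) simp
    then have "ipoly U (\<theta> ^ k) ^ m = 0" by (simp add: R_def)
    then show ?thesis by simp
  qed
  \<comment> \<open>This is where reducedness of the group ring enters: \<open>U\<close> has degree
    below \<open>N\<close> and vanishes at the \<open>N\<close> distinct powers of the
    generator.\<close>
  have "(map_poly of_int U :: 'a poly) = 0"
  proof (rule ccontr)
    assume nz: "(map_poly of_int U :: 'a poly) \<noteq> 0"
    have inj: "inj_on (\<lambda>k. \<theta> ^ k) {..<N}" using bij by (rule bij_betw_imp_inj_on)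
    have "(\<lambda>k. \<theta> ^ k) ` {..<N} \<subseteq> {x. poly (map_poly of_int U) x = 0}"
      using U0 by (auto simp: ipoly_def)
    then have "N \<le> card {x :: 'a. poly (map_poly of_int U) x = 0}"
      using card_mono[OF poly_roots_finite[OF nz]] card_image[OF inj] by (metis card_lessThan)
    also have "\<dots> \<le> degree (map_poly of_int U :: 'a poly)" by (rule card_poly_roots_bound[OF nz])
    also have "\<dots> \<le> degree U" by (rule degree_le) (simp add: coeff_map_poly coeff_eq_0)
    also have "\<dots> \<le> N - 1" unfolding U_def
      by (rule degree_sum_le) (auto intro: order.trans[OF degree_monom_le])
    finally show False using N by simp
  qed
  then have U_coeff: "(of_int (coeff U k) :: 'a) = 0" for k
    by (metis coeff_0 coeff_map_poly of_int_0)
  have "a \<in> fixed_field f - {0}" using a by simp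
  then obtain k where k: "k < N" "a = \<theta> ^ k" using bij_betw_imp_surj_on[OF bij] by blast
  have "coeff U k = u a" using k(1) by (simp add: U_def coeff_sum k(2))
  then show ?thesis using U_coeff[of k] by (simp add: of_int_eq_0_iff_char_dvd)
qed

end

section \<open>Weil sums over a quadratic extension\<close>

text \<open>The condition is stated with 1 because that is what the third moment counts; on
  subfields, homogeneity upgrades it to full additivity.\<close>

definition additive_power_on :: "nat \<Rightarrow> 'b::field set \<Rightarrow> bool" where
  "additive_power_on D S \<longleftrightarrow> (\<forall>x\<in>S. (x + 1) ^ D = x ^ D + 1)"

lemma additive_power_onD:
  assumes "additive_power_on D (fixed_field f :: 'a::{finite,field} set)" "D > 0"
    and x: "x \<in> (fixed_field f :: 'a set)" and y: "y \<in> (fixed_field f :: 'a set)"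
  shows "(x + y) ^ D = x ^ D + y ^ D"
proof (cases "y = 0")
  case False
  have "x * inverse y \<in> fixed_field f"
    using fixed_field_simps(4)[OF refl prime_CHAR_finite x fixed_field_simps(7)[OF refl prime_CHAR_finite y]] .
  then have "(x * inverse y + 1) ^ D = (x * inverse y) ^ D + 1"
    using assms(1) by (simp add: additive_power_on_def)
  moreover have "x + y = y * (x * inverse y + 1)" "y * (x * inverse y) = x" using False by (simp_all add: ring_distribs)
  ultimately show ?thesis by (metis mult.right_neutral power_mult_distrib ring_distribs(1))
qed (use assms(2) in \<open>simp add: zero_power\<close>)

lemma additive_power_on_sum:
  assumes add: "additive_power_on D (fixed_field f :: 'a::{finite,field} set)" and D: "D > 0"
    and "finite A" and "\<And>i. i \<in> A \<Longrightarrow> g i \<in> (fixed_field f :: 'a set)"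
  shows "(\<Sum>i\<in>A. g i) ^ D = (\<Sum>i\<in>A. g i ^ D) \<and> (\<Sum>i\<in>A. g i) \<in> fixed_field f"
  using assms(3,4)
proof (induction A)
  case empty
  then show ?case using D fixed_field_simps(1)[OF refl prime_CHAR_finite[where ?'a = 'a]] by (simp add: zero_power)
next
  case (insert i A)
  then have IH: "(\<Sum>i\<in>A. g i) ^ D = (\<Sum>i\<in>A. g i ^ D)" "(\<Sum>i\<in>A. g i) \<in> fixed_field f" and gi: "g i \<in> fixed_field f" by auto
  show ?case
    using additive_power_onD[OF add D gi IH(2)] IH gi insert(1,2)
      fixed_field_simps(3)[OF refl prime_CHAR_finite[where ?'a = 'a] gi IH(2)] by simp
qed

text \<open>The power map is additive and fixes 1, hence fixes every multiple of 1.\<close>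

lemma prime_field_power:
  assumes add: "additive_power_on D (fixed_field f :: 'a::{finite,field} set)" and D: "D > 0"
    and x: "x \<in> (prime_field :: 'a set)"
  shows "x ^ D = x"
proof -
  obtain k where k: "x = of_nat k"
    using x unfolding prime_field_eq[OF refl prime_CHAR_finite] by (rule imageE)
  have "(of_nat k :: 'a) ^ D = of_nat k"
  proof (induction k)
    case 0
    show ?case using D by (simp add: zero_power)
  next
    case (Suc k)
    have "(of_nat k + 1 :: 'a) ^ D = of_nat k ^ D + 1"
      using add of_nat_fixed_field by (auto simp: additive_power_on_def)
    then show ?case using Suc by (simp add: add.commute)
  qed
  then show ?thesis by (simp add: k)
qed

text \<open>The power map commutes with sums and with Frobenius, so the trace of
  \<open>x ^ D\<close> is the \<open>D\<close>-th power of the trace, which lies in the prime field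
  and is fixed.\<close>

lemma trace_char_power:
  assumes add: "additive_power_on D (fixed_field f :: 'a::{finite,field} set)" and D: "D > 0"
    and x: "x \<in> (fixed_field f :: 'a set)"
  shows "trace_char f (x ^ D) = trace_char f x"
proof -
  note p = refl prime_CHAR_finite[where ?'a = 'a]
  have "ff_trace f (x ^ D) = (\<Sum>i<f. (x ^ (CHAR('a) ^ i)) ^ D)"
    by (simp add: ff_trace_def mult.commute flip: power_mult)
  also have "\<dots> = ff_trace f x ^ D"
    using additive_power_on_sum[OF add D finite_lessThan[of f], of "\<lambda>i. x ^ (CHAR('a) ^ i)"]
      fixed_field_simps(6)[OF p x] by (simp add: ff_trace_def)
  also have "\<dots> = ff_trace f x"
    by (rule prime_field_power[OF add D ff_trace_in_prime_field[OF p x]])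
  finally show ?thesis by (simp add: trace_char_def)
qed

text \<open>The units of the base field have index \<open>l + 1\<close> in those of its quadratic
  extension. Raising to the power \<open>l - 1\<close> kills the base units and so separates the
  cosets; counting gives surjectivity.\<close>

lemma quadratic_coset_representatives:
  assumes dvd: "2 * f dvd fdeg TYPE('a::{finite,field})" and f: "f > 0"
  defines "l \<equiv> CHAR('a::{finite,field}) ^ f"
  obtains \<theta> :: "'a::{finite,field}" where "\<theta> \<in> fixed_field (2 * f)"
    "bij_betw (\<lambda>(r, c). \<theta> ^ r * c) ({..<l + 1} \<times> (fixed_field f - {0})) (fixed_field (2 * f) - {0 :: 'a})"
proof -
  note p = refl prime_CHAR_finite[where ?'a = 'a]
  have l1: "l > 1" unfolding l_def using prime_gt_1_nat[OF p(2)] f by (rule one_less_power)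
  have dvd1: "f dvd fdeg TYPE('a)" using dvd by (meson dvd_mult_right)
  have f2: "2 * f > 0" using f by simp
  define N where "N = CHAR('a) ^ (2 * f) - 1"
  have "l ^ 2 = CHAR('a) ^ (2 * f)" by (simp add: l_def mult.commute flip: power_mult)
  moreover have "(l + 1) * (l - 1) = l ^ 2 - 1" using l1 by (simp add: algebra_simps power2_eq_square)
  ultimately have N: "N = (l + 1) * (l - 1)" by (simp add: N_def)
  obtain \<theta> :: 'a where t0: "\<theta> \<noteq> 0" and tN: "\<theta> ^ N = 1" and bij: "bij_betw (\<lambda>k. \<theta> ^ k) {..<N} (fixed_field (2 * f) - {0})"
    and eq: "\<And>i j. \<theta> ^ i = \<theta> ^ j \<longleftrightarrow> i mod N = j mod N"
    by (rule fixed_field_generator[OF dvd f2, folded N_def]) (rule that)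
  have "1 < N"
  proof -
    have "3 * 1 \<le> (l + 1) * (l - 1)" using l1 by (intro mult_mono) auto
    then show ?thesis by (simp add: N)
  qed
  then have tin: "\<theta> \<in> fixed_field (2 * f)" using bij_betw_apply[OF bij, of 1] by simp
  let ?g = "\<lambda>(r, c). \<theta> ^ r * c"
  let ?A = "{..<l + 1} \<times> (fixed_field f - {0 :: 'a})"
  have pow1: "c ^ (l - 1) = 1" if "c \<in> fixed_field f" "c \<noteq> (0 :: 'a)" for c
  proof -
    have "c * c ^ (l - 1) = c ^ l" using l1 by (metis Suc_diff_1 less_trans power_Suc zero_less_one)
    also have "\<dots> = c" using that(1) by (simp add: fixed_field_def l_def)
    finally show ?thesis using that(2) by simp
  qed
  have no: False
    if "r < s" "s < l + 1" "c \<in> fixed_field f - {0}" "e \<in> fixed_field f - {0}" "\<theta> ^ r * c = \<theta> ^ s * e"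
    for r s and c e :: 'a
  proof -
    have "\<theta> ^ s = \<theta> ^ r * \<theta> ^ (s - r)" using that(1) by (simp flip: power_add)
    then have "c = \<theta> ^ (s - r) * e" using that(5) t0 by simp
    then have "c ^ (l - 1) = \<theta> ^ ((s - r) * (l - 1)) * e ^ (l - 1)"
      by (simp add: power_mult_distrib power_mult)
    then have "\<theta> ^ ((s - r) * (l - 1)) = \<theta> ^ 0" using pow1[of c] pow1[of e] that(3,4) by simp
    then have "((s - r) * (l - 1)) mod ((l + 1) * (l - 1)) = 0" by (simp only: eq N mod_0)
    then have "(l + 1) * (l - 1) dvd (s - r) * (l - 1)" by (rule mod_0_imp_dvd)
    moreover have "l - 1 \<noteq> 0" using l1 by simp
    ultimately have "l + 1 dvd s - r" using dvd_times_right_cancel_iff[of "l - 1" "l + 1" "s - r"] by blast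
    then have "l + 1 \<le> s - r" using that(1) by (intro dvd_imp_le) auto
    then show False using that(2) by simp
  qed
  have inj: "inj_on ?g ?A"
  proof (rule inj_onI)
    fix a b assume ab: "a \<in> ?A" "b \<in> ?A" "?g a = ?g b"
    obtain r c s e where rc: "a = (r, c)" "b = (s, e)" by (cases a, cases b)
    have "\<not> r < s" "\<not> s < r" using no[of r s c e] no[of s r e c] ab by (auto simp: rc)
    then show "a = b" using ab t0 by (auto simp: rc)
  qed
  have sub: "?g ` ?A \<subseteq> fixed_field (2 * f) - {0}"
  proof -
    have "\<theta> ^ r * c \<in> fixed_field (2 * f)" if "c \<in> fixed_field f" for r c
      using fixed_field_mono[OF p, of f "2 * f"] that fixed_field_simps(4,6)[OF p] tin by (auto simp: subset_iff)
    then show ?thesis using t0 by auto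
  qed
  have card0: "card (fixed_field e - {0 :: 'a}) = CHAR('a) ^ e - 1" if "e dvd fdeg TYPE('a)" "e > 0" for e
    using card_fixed_field[OF that] fixed_field_simps(1)[OF p] by (simp add: card_Diff_singleton)
  have "card (?g ` ?A) = card (fixed_field (2 * f) - {0 :: 'a})"
    unfolding card_image[OF inj] card_cartesian_product card0[OF dvd1 f] card0[OF dvd f2]
    using N by (simp add: N_def l_def)
  then have "?g ` ?A = fixed_field (2 * f) - {0}" by (intro card_subset_eq[OF _ sub]) simp_all
  then show thesis using inj tin by (intro that) (auto simp: bij_betw_def)
qed

text \<open>On a coset \<open>\<theta> ^ r * c\<close> the summand becomes
  \<open>trace_char f (w r * c ^ D)\<close>, so each coset contributes \<open>l - 1\<close> or
  \<open>-1\<close> according to whether \<open>w r = 0\<close>. With the term 1 from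
  \<open>x = 0\<close> the total is \<open>1 + l * n - (l + 1)\<close>.\<close>

lemma subfield_sum_quadratic:
  assumes dvd: "2 * f dvd fdeg TYPE('a::{finite,field})" and f: "f > 0" and D: "D > 0"
    and bijD: "bij_betw (\<lambda>x. x ^ D) (fixed_field f) (fixed_field f :: 'a set)"
    and add: "additive_power_on D (fixed_field f :: 'a set)" and a: "a \<in> fixed_field (2 * f)"
  shows "\<exists>n \<le> CHAR('a) ^ f + 1. subfield_sum (2 * f) D (a :: 'a)
    = of_nat (CHAR('a) ^ f) * (of_nat n - 1)"
proof -
  note p = refl prime_CHAR_finite[where ?'a = 'a]
  define l where "l = CHAR('a) ^ f"
  have dvd1: "f dvd fdeg TYPE('a)" using dvd by (meson dvd_mult_right)
  interpret F: field_character "fixed_field f :: 'a set" "trace_char f"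
    by (rule field_character_fixed_field[OF dvd1 f])
  interpret L: field_character "fixed_field (2 * f) :: 'a set" "trace_char (2 * f)"
    by (rule field_character_fixed_field[OF dvd]) (use f in simp)
  have cardF: "card (fixed_field f :: 'a set) = l" using card_fixed_field[OF dvd1 f] by (simp add: l_def)
  \<comment> \<open>The relative trace to the subfield of order \<open>l\<close>.\<close>
  define T where "T z = z + z ^ l" for z :: 'a
  have T_in: "T z \<in> fixed_field f" if "z \<in> fixed_field (2 * f)" for z
  proof -
    have "(z ^ l) ^ l = z"
      using that by (simp add: fixed_field_def l_def mult_2 power_add flip: power_mult)
    then have "T z ^ l = T z"
      unfolding T_def l_def frob_pow_add[OF p] by (simp add: add.commute)
    then show ?thesis by (simp add: fixed_field_def l_def)
  qed
  have psi_T: "trace_char (2 * f) z = trace_char f (T z)" for z :: 'a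
    using trace_char_trans[OF p, of f 2 z] by (simp add: T_def l_def numeral_2_eq_2)
  have T_add: "T (x + y) = T x + T y" for x y
    by (simp add: T_def l_def frob_pow_add[OF p])
  have T_scale: "T (c * x) = c * T x" if "c \<in> fixed_field f" for c x
    using that by (simp add: T_def l_def fixed_field_def power_mult_distrib ring_distribs)
  obtain \<theta> :: 'a where tin: "\<theta> \<in> fixed_field (2 * f)"
    and bij: "bij_betw (\<lambda>(r, c). \<theta> ^ r * c) ({..<l + 1} \<times> (fixed_field f - {0})) (fixed_field (2 * f) - {0 :: 'a})"
    unfolding l_def by (rule quadratic_coset_representatives[OF dvd f])
  define w where "w r = T ((\<theta> ^ r) ^ D) + T (a * \<theta> ^ r) ^ D" for r
  have w_in: "w r \<in> fixed_field f" for r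
    unfolding w_def using tin a by (intro F.closed T_in L.closed)
  have orbit_term: "trace_char (2 * f) ((\<theta> ^ r * c) ^ D + a * (\<theta> ^ r * c)) = trace_char f (w r * c ^ D)"
    if c: "c \<in> fixed_field f" for r c
  proof -
    have in1: "T ((\<theta> ^ r) ^ D) \<in> fixed_field f" "T (a * \<theta> ^ r) \<in> fixed_field f"
      using tin a by (auto intro!: T_in L.closed)
    have "T ((\<theta> ^ r * c) ^ D + a * (\<theta> ^ r * c)) = T (c ^ D * (\<theta> ^ r) ^ D) + T (c * (a * \<theta> ^ r))"
      by (simp add: T_add power_mult_distrib mult_ac)
    also have "\<dots> = c ^ D * T ((\<theta> ^ r) ^ D) + c * T (a * \<theta> ^ r)"
      using c by (simp add: T_scale F.closed)
    finally have "trace_char (2 * f) ((\<theta> ^ r * c) ^ D + a * (\<theta> ^ r * c))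
        = trace_char f (c ^ D * T ((\<theta> ^ r) ^ D)) * trace_char f (c * T (a * \<theta> ^ r))"
      unfolding psi_T using c in1 by (simp add: F.psi_add F.closed)
    \<comment> \<open>The linear term may be raised to the power \<open>D\<close> under the
      character; then both terms are proportional to \<open>c ^ D\<close> and combine. This is where
      additivity on the smaller field is used.\<close>
    also have "trace_char f (c * T (a * \<theta> ^ r)) = trace_char f ((c * T (a * \<theta> ^ r)) ^ D)"
      using c in1 by (intro trace_char_power[OF add D, symmetric] F.closed)
    also have "trace_char f (c ^ D * T ((\<theta> ^ r) ^ D)) * trace_char f ((c * T (a * \<theta> ^ r)) ^ D)
        = trace_char f (w r * c ^ D)"
      using c in1 by (simp add: w_def ring_distribs power_mult_distrib mult_ac F.closed flip: F.psi_add)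
    finally show ?thesis .
  qed
  have inner: "(\<Sum>c\<in>fixed_field f - {0}. trace_char f (w r * c ^ D)) = (if w r = 0 then of_nat l else 0) - 1" for r
  proof -
    have "(\<Sum>c\<in>fixed_field f. trace_char f (w r * c ^ D)) = (\<Sum>c\<in>fixed_field f. trace_char f (w r * c))"
      by (rule F.sum_power[OF D bijD])
    also have "\<dots> = (if w r = 0 then of_nat l else 0)"
      using F.sum_psi_mult[OF w_in[of r]] by (simp only: cardF)
    also have "(\<Sum>c\<in>fixed_field f. trace_char f (w r * c ^ D))
        = trace_char f (w r * 0 ^ D) + (\<Sum>c\<in>fixed_field f - {0}. trace_char f (w r * c ^ D))"
      by (rule sum.remove) simp_all
    finally show ?thesis using D by (simp add: zero_power eq_diff_eq add.commute)
  qed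
  define n where "n = card {r \<in> {..<l + 1}. w r = 0}"
  have "subfield_sum (2 * f) D a
      = 1 + (\<Sum>x\<in>fixed_field (2 * f) - {0}. trace_char (2 * f) (x ^ D + a * x))"
    unfolding subfield_sum_def
    by (subst sum.remove[OF L.finite_S L.zero_S]) (use D in \<open>simp add: zero_power\<close>)
  also have "(\<Sum>x\<in>fixed_field (2 * f) - {0}. trace_char (2 * f) (x ^ D + a * x))
      = (\<Sum>(r, c)\<in>{..<l + 1} \<times> (fixed_field f - {0}). trace_char (2 * f) ((\<theta> ^ r * c) ^ D + a * (\<theta> ^ r * c)))"
    by (subst sum.reindex_bij_betw[OF bij, symmetric]) (simp add: case_prod_unfold)
  also have "\<dots> = (\<Sum>r<l + 1. \<Sum>c\<in>fixed_field f - {0}. trace_char f (w r * c ^ D))"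
    unfolding sum.cartesian_product[symmetric] by (intro sum.cong refl orbit_term) auto
  also have "\<dots> = (\<Sum>r<l + 1. (if w r = 0 then of_nat l else 0) - 1)"
    by (simp only: inner)
  also have "\<dots> = of_nat l * of_nat n - of_nat (l + 1)"
  proof -
    have "(\<Sum>r<l + 1. if w r = 0 then of_nat l else 0 :: complex) = (\<Sum>r\<in>{r \<in> {..<l + 1}. w r = 0}. of_nat l)"
      by (rule sum.inter_filter[symmetric]) simp
    then show ?thesis unfolding sum_subtractf n_def by (simp only: sum_constant card_lessThan mult.commute mult_1_right mult_1_left)
  qed
  finally have "subfield_sum (2 * f) D a = of_nat l * (of_nat n - 1)"
    by (simp add: algebra_simps)
  moreover have "n \<le> l + 1"
    unfolding n_def by (rule order.trans[OF card_mono[of "{..<l + 1}"]]) auto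
  ultimately show ?thesis unfolding l_def by blast
qed

section \<open>Climbing the tower of quadratic extensions\<close>

text \<open>With \<open>?W = l * u\<close>, the factor \<open>p\<close> that \<open>P\<close> has
  beyond \<open>l ^ m\<close> makes \<open>p\<close> divide \<open>u\<close> at nonzero arguments
  and excludes the value \<open>-1\<close>. The first three moments then determine
  everything.\<close>

lemma additive_power_on_quadratic_extension:
  fixes v :: "'a::{finite,field} \<Rightarrow> int" and P :: int
  assumes n: "fdeg TYPE('a) = 2 * f * m" and f: "f > 0" and m: "m > 0"
    and D: "D > 0" and bijD: "bij (\<lambda>x :: 'a. x ^ D)" and E: "\<And>x :: 'a. (x ^ D) ^ E = x"
    and add: "additive_power_on D (fixed_field f :: 'a set)"
    and v: "\<And>a :: 'a. a \<noteq> 0 \<Longrightarrow> subfield_sum (2 * f * m) D a = of_int (P * v a)"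
    and P: "int CHAR('a) ^ (f * m + 1) dvd P"
  shows "additive_power_on D (fixed_field (2 * f) :: 'a set)"
proof -
  note p = prime_CHAR_finite[where ?'a = 'a]
  have p1: "CHAR('a) > 1" using prime_gt_1_nat[OF p] .
  define l where "l = CHAR('a) ^ f"
  have l0: "l > 0" using p1 by (simp add: l_def)
  let ?L = "fixed_field (2 * f) :: 'a set"
  let ?W = "subfield_sum (2 * f) D :: 'a \<Rightarrow> complex"
  have f2: "2 * f > 0" and dvd: "2 * f dvd fdeg TYPE('a)" using f by (simp_all add: n)
  have dvd1: "f dvd fdeg TYPE('a)" by (simp add: n)
  interpret L: field_character ?L "trace_char (2 * f)" by (rule field_character_fixed_field[OF dvd f2])
  have W: "L.wsum D a = ?W a" for a by (simp add: L.wsum_def subfield_sum_def)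
  note bijL = bij_betw_power_fixed_field[OF bijD, of "2 * f"]
  have cardL: "card ?L = l ^ 2"
    using card_fixed_field[OF dvd f2] by (simp add: l_def mult.commute flip: power_mult)
  have "\<forall>a\<in>?L. \<exists>u::int. - 1 \<le> u \<and> u \<le> int l \<and> ?W a = of_int (int l * u)"
  proof
    fix a assume "a \<in> ?L"
    then obtain j where "j \<le> l + 1" "?W a = of_nat l * (of_nat j - 1)"
      using subfield_sum_quadratic[OF dvd f D bij_betw_power_fixed_field[OF bijD] add] unfolding l_def by blast
    then show "\<exists>u::int. - 1 \<le> u \<and> u \<le> int l \<and> ?W a = of_int (int l * u)"
      by (intro exI[of _ "int j - 1"]) simp
  qed
  then obtain u where u: "\<And>a. a \<in> ?L \<Longrightarrow> - 1 \<le> u a" "\<And>a. a \<in> ?L \<Longrightarrow> u a \<le> int l"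
    "\<And>a. a \<in> ?L \<Longrightarrow> ?W a = of_int (int l * u a)" by metis
  define N where "N = CHAR('a) ^ (2 * f) - 1"
  have pf1: "1 < CHAR('a) ^ (2 * f)" using p1 f2 by (rule one_less_power)
  then have N: "N > 0" "CHAR('a) ^ (2 * f) = N + 1" by (simp_all add: N_def)
  obtain \<theta> :: 'a where "\<theta> \<noteq> 0" "\<theta> ^ N = 1" and bij: "bij_betw (\<lambda>k. \<theta> ^ k) {..<N} (?L - {0})"
    and eq: "\<And>i j. \<theta> ^ i = \<theta> ^ j \<longleftrightarrow> i mod N = j mod N"
    by (rule fixed_field_generator[OF dvd f2, folded N_def]) (rule that)
  have dlog: "\<theta> ^ inv_into {..<N} (\<lambda>k. \<theta> ^ k) y = y" if "y \<in> ?L" "y \<noteq> 0" for y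
    using f_inv_into_f[of y "\<lambda>k. \<theta> ^ k" "{..<N}"] bij_betw_imp_surj_on[OF bij] that by simp
  have "int l ^ m * int CHAR('a) dvd P"
    using P by (simp add: l_def power_mult mult.commute)
  moreover have "int l \<noteq> 0" using l0 by simp
  ultimately have dvd_u: "int CHAR('a) dvd u a" if "a \<in> ?L" "a \<noteq> 0" for a
    using weil_divisibility[OF n f2 m D bijD E N bij eq dlog u(3) v _ _ that] by blast
  have u_nonneg: "0 \<le> u a" if a: "a \<in> ?L" for a
  proof (cases "a = 0")
    case True
    have "complex_of_int (int l * u 0) = 0" using u(3)[OF L.zero_S] L.wsum_0[OF D bijL] by (simp add: W)
    then show ?thesis using l0 True by simp
  next
    case False
    have "u a \<noteq> - 1"
    proof
      assume "u a = - 1"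
      then have "int CHAR('a) dvd 1" using dvd_u[OF a False] by simp
      then show False using p1 by simp
    qed
    then show ?thesis using u(1)[OF a] by simp
  qed
  have sum1: "(\<Sum>a\<in>?L. u a) = int l"
  proof -
    have "complex_of_int (int l * (\<Sum>a\<in>?L. u a)) = of_int (int l ^ 2)"
      using L.sum_wsum[OF D bijL] by (simp add: W u(3) cardL sum_distrib_left)
    then have "int l * (\<Sum>a\<in>?L. u a) = int l ^ 2" by (simp only: of_int_eq_iff)
    then show ?thesis using l0 by (simp add: power2_eq_square)
  qed
  have sum2: "(\<Sum>a\<in>?L. u a ^ 2) = int l ^ 2"
  proof -
    have "complex_of_int (int l ^ 2 * (\<Sum>a\<in>?L. u a ^ 2)) = of_int (int l ^ 4)"
      using L.sum_wsum_square[OF D bijL]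
      by (simp add: W u(3) cardL sum_distrib_left power_mult_distrib flip: power_mult)
    then have "int l ^ 2 * (\<Sum>a\<in>?L. u a ^ 2) = int l ^ 2 * int l ^ 2"
      by (simp only: of_int_eq_iff) (simp flip: power_add)
    moreover have "int l ^ 2 \<noteq> 0" using l0 by simp
    ultimately show ?thesis by (simp only: mult_cancel_left simp_thms)
  qed
  have u2: "u a ^ 2 = int l * u a" if a: "a \<in> ?L" for a
  proof -
    \<comment> \<open>The summands \<open>u * (l - u)\<close> are nonnegative and add up to
      \<open>l * l - l ^ 2\<close>, so each is zero and \<open>u\<close> takes only the values 0 and
      \<open>l\<close>.\<close>
    have "(\<Sum>a\<in>?L. int l * u a - u a ^ 2) = 0"
      unfolding sum_subtractf sum2 sum_distrib_left[symmetric] sum1 by (simp add: power2_eq_square)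
    moreover have "0 \<le> int l * u a - u a ^ 2" if "a \<in> ?L" for a
      using mult_right_mono[OF u(2)[OF that] u_nonneg[OF that]] by (simp add: power2_eq_square)
    ultimately have "int l * u a - u a ^ 2 = 0"
      using sum_nonneg_eq_0_iff[OF L.finite_S, of "\<lambda>a. int l * u a - u a ^ 2"] a by blast
    then show ?thesis by simp
  qed
  let ?U = "{t \<in> ?L. (t + 1) ^ D = t ^ D + 1}"
  have "(\<Sum>a\<in>?L. u a ^ 3) = int l ^ 3"
  proof -
    have "(\<Sum>a\<in>?L. u a ^ 3) = (\<Sum>a\<in>?L. int l ^ 2 * u a)"
    proof (rule sum.cong[OF refl])
      fix a assume a: "a \<in> ?L"
      have "u a ^ 3 = u a * u a ^ 2" by (simp add: power3_eq_cube power2_eq_square)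
      also have "\<dots> = u a * (int l * u a)" by (simp only: u2[OF a])
      also have "\<dots> = int l * u a ^ 2" by (simp only: power2_eq_square mult_ac)
      also have "\<dots> = int l * (int l * u a)" by (simp only: u2[OF a])
      also have "\<dots> = int l ^ 2 * u a" by (simp only: power2_eq_square mult_ac)
      finally show "u a ^ 3 = int l ^ 2 * u a" .
    qed
    then show ?thesis by (simp add: sum1 power3_eq_cube power2_eq_square flip: sum_distrib_left)
  qed
  \<comment> \<open>The third moment computed in two ways gives
    \<open>l ^ 6 = l ^ 4 * card ?U\<close>, so \<open>?U\<close> has as many elements as the
    extension.\<close>
  moreover have "complex_of_int (int l ^ 3 * (\<Sum>a\<in>?L. u a ^ 3)) = of_int (int l ^ 4 * int (card ?U))"
    using L.sum_wsum_cube[OF D bijL]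
    by (simp add: W u(3) cardL sum_distrib_left power_mult_distrib flip: power_mult)
  ultimately have "int l ^ 3 * int l ^ 3 = int l ^ 4 * int (card ?U)" by (simp only: of_int_eq_iff)
  moreover have "int l ^ 3 * int l ^ 3 = int l ^ 4 * int (l ^ 2)" by (simp flip: power_add)
  ultimately have "int l ^ 4 * int (card ?U) = int l ^ 4 * int (l ^ 2)" by (simp only:)
  moreover have "int l ^ 4 \<noteq> 0" using l0 by simp
  ultimately have "int (card ?U) = int (l ^ 2)" by (simp only: mult_cancel_left simp_thms)
  then have "card ?U = card ?L" by (simp only: cardL of_nat_eq_iff)
  then have "?U = ?L" by (intro card_subset_eq) auto
  then show ?thesis by (auto simp: additive_power_on_def)
qed

text \<open>Integral Weil sums are unchanged under conjugation by \<open>x\<close> in the prime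
  field. With \<open>e ^ D = x\<close>, conjugation amounts to scaling \<open>a\<close> by
  \<open>x / e\<close>, so \<open>wsum_scale_invariant\<close> yields \<open>x = e\<close>.\<close>

lemma additive_power_on_prime_field:
  fixes w :: "'a::{finite,field} \<Rightarrow> int"
  assumes n: "n = fdeg TYPE('a)" and D: "D > 0" and bijD: "bij (\<lambda>x :: 'a. x ^ D)"
    and w: "\<And>a :: 'a. subfield_sum n D a = of_int (w a)"
  shows "additive_power_on D (fixed_field 1 :: 'a set)"
proof -
  note p = refl prime_CHAR_finite[where ?'a = 'a]
  have univ: "fixed_field n = (UNIV :: 'a set)" by (simp add: n fixed_field_fdeg)
  interpret K: field_character "UNIV :: 'a set" "trace_char n"
    using field_character_UNIV[where ?'a = 'a] by (simp only: n)
  have bijU: "bij_betw (\<lambda>x :: 'a. x ^ D) UNIV UNIV" using bijD .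
  have W: "K.wsum D a = subfield_sum n D a" for a by (simp add: K.wsum_def subfield_sum_def univ)
  have power_eq: "x ^ D = x" if pf: "x \<in> prime_field" for x :: 'a
  proof (cases "x = 0")
    case True
    then show ?thesis using D by (simp add: zero_power)
  next
    case False
    obtain c where c: "x = of_nat c" using pf unfolding prime_field_eq[OF p] by (rule imageE)
    have "\<not> CHAR('a) dvd c" using False by (simp add: c of_nat_eq_0_iff_char_dvd)
    obtain e where e: "e ^ D = x" using bij_is_surj[OF bijD] by (metis surjD)
    then have e0: "e \<noteq> 0" using False D by (auto simp: zero_power)
    have "K.wsum D (x / e * a) = K.wsum D a" for a
    proof -
      have "(\<Sum>y\<in>UNIV. trace_char n (of_nat c * (y ^ D + a * y))) = of_int (w a)"
        by (rule sum_trace_char_conjugate[OF _ \<open>\<not> CHAR('a) dvd c\<close>])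
          (use w[of a] in \<open>simp_all add: univ subfield_sum_def\<close>)
      \<comment> \<open>The factor \<open>c\<close> is absorbed into the power term by
        \<open>e ^ D = c\<close>, and the linear term is adjusted accordingly; then
        \<open>e * y\<close> is the new variable.\<close>
      moreover have "(\<Sum>y\<in>UNIV. trace_char n (of_nat c * (y ^ D + a * y)))
          = (\<Sum>y\<in>UNIV. trace_char n ((e * y) ^ D + (x / e * a) * (e * y)))"
        using e0 by (intro sum.cong refl) (simp add: power_mult_distrib e ring_distribs c mult_ac)
      moreover have "\<dots> = K.wsum D (x / e * a)"
        unfolding K.wsum_def by (rule K.sum_scale[OF UNIV_I e0])
      ultimately show ?thesis using w by (simp add: W)
    qed
    then have "x / e = 1"
      by (intro K.wsum_scale_invariant[OF D bijU]) (use False e0 in auto)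
    then show ?thesis using e e0 by simp
  qed
  have eq: "fixed_field 1 = (prime_field :: 'a set)" by (simp add: fixed_field_def prime_field_def)
  show ?thesis unfolding additive_power_on_def
  proof
    fix x :: 'a assume x: "x \<in> fixed_field 1"
    then have "x + 1 \<in> fixed_field 1" using fixed_field_simps(2,3)[OF p] by blast
    then show "(x + 1) ^ D = x ^ D + 1" using x power_eq unfolding eq by simp
  qed
qed

text \<open>First and third moment give \<open>A ^ 2 = q * card U\<close>; the induction along the
  tower puts the subfield of order \<open>p ^ (2 ^ t)\<close> inside \<open>U\<close>.\<close>

lemma three_valued_bound:
  assumes n: "n = fdeg TYPE('a::{finite,field})" and D: "D > 0" and bijD: "bij (\<lambda>x :: 'a. x ^ D)"
    and E: "\<And>x :: 'a. (x ^ D) ^ E = x"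
    and vals: "\<And>a :: 'a. a \<noteq> 0 \<Longrightarrow> subfield_sum n D a \<in> {0, A, - A}"
  shows "\<exists>u \<ge> CHAR('a) ^ (2 ^ multiplicity 2 n). A ^ 2 = of_nat (CARD('a) * u)"
proof -
  let ?p = "CHAR('a)" and ?q = "CARD('a)"
  note p = refl prime_CHAR_finite[where ?'a = 'a]
  have p1: "?p > 1" using prime_gt_1_nat[OF p(2)] .
  have n0: "n > 0" using fdeg_pos n by metis
  have q: "?q = ?p ^ n" by (simp add: CARD_eq_CHAR_power n)
  have univ: "fixed_field n = (UNIV :: 'a set)" by (simp add: n fixed_field_fdeg)
  interpret K: field_character "UNIV :: 'a set" "trace_char n"
    using field_character_UNIV[where ?'a = 'a] by (simp only: n)
  have bijU: "bij_betw (\<lambda>x :: 'a. x ^ D) UNIV UNIV" using bijD .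
  have W: "K.wsum D a = subfield_sum n D a" for a by (simp add: K.wsum_def subfield_sum_def univ)
  define U where "U = {t \<in> UNIV :: 'a set. (t + 1) ^ D = t ^ D + 1}"
  \<comment> \<open>The three values are recorded as a sign \<open>s\<close> in
    \<open>{0, 1, -1}\<close>; \<open>s ^ 3 = s\<close> makes the third moment proportional to the
    first.\<close>
  have "\<exists>s::int. subfield_sum n D a = A * of_int s \<and> s ^ 3 = s" for a :: 'a
  proof (cases "a = 0")
    case True
    then show ?thesis using K.wsum_0[OF D bijU] by (intro exI[of _ 0]) (simp add: W)
  next
    case False
    then consider "subfield_sum n D a = 0" | "subfield_sum n D a = A" | "subfield_sum n D a = - A"
      using vals by blast
    then show ?thesis
      by cases (auto intro: exI[of _ 0] exI[of _ 1] exI[of _ "- 1"])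
  qed
  then obtain s :: "'a \<Rightarrow> int" where s: "\<And>a. subfield_sum n D a = A * of_int (s a)" "\<And>a. s a ^ 3 = s a"
    by metis
  define S where "S = (\<Sum>a\<in>UNIV. s a)"
  have AS: "A * of_int S = of_nat ?q"
    using K.sum_wsum[OF D bijU] by (simp add: W s S_def sum_distrib_left)
  have "A ^ 2 * (A * of_int S) = of_nat ?q ^ 2 * of_nat (card U)"
  proof -
    have "of_int (s a) ^ 3 = (of_int (s a) :: complex)" for a by (metis of_int_power s(2))
    then have "K.wsum D a ^ 3 = A ^ 3 * of_int (s a)" for a
      by (simp only: W s(1) power_mult_distrib)
    then have "A ^ 3 * of_int S = (\<Sum>a\<in>UNIV. K.wsum D a ^ 3)"
      by (simp only: S_def of_int_sum sum_distrib_left)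
    also have "\<dots> = of_nat ?q ^ 2 * of_nat (card U)"
      unfolding U_def by (rule K.sum_wsum_cube[OF D bijU])
    finally show ?thesis by (simp only: power2_eq_square power3_eq_cube mult.assoc)
  qed
  then have A2: "A ^ 2 = of_nat (?q * card U)"
    by (simp add: AS power2_eq_square)
  \<comment> \<open>Integrality of \<open>A\<close>: multiplying by \<open>q = A * S\<close> and
    using \<open>A ^ 2 = q * card U\<close> lets \<open>q\<close> be cancelled.\<close>
  have A_eq: "A = of_int (S * int (card U))"
  proof -
    have "of_nat ?q * A = A * of_int S * A" by (simp only: AS)
    also have "\<dots> = A ^ 2 * of_int S" by (simp only: power2_eq_square mult_ac)
    also have "\<dots> = of_nat ?q * (of_int S * of_nat (card U))" by (simp only: A2 of_nat_mult mult_ac)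
    finally show ?thesis by simp
  qed
  define B where "B = S * int (card U)"
  have BS: "B * S = int ?q"
  proof -
    have "complex_of_int (B * S) = of_int (int ?q)" using AS by (simp add: A_eq B_def)
    then show ?thesis by (simp only: of_int_eq_iff)
  qed
  have B2: "B ^ 2 = int (?q * card U)"
  proof -
    have "complex_of_int (B ^ 2) = of_int (int (?q * card U))" using A2 by (simp add: A_eq B_def)
    then show ?thesis by (simp only: of_int_eq_iff)
  qed
  have "B dvd int ?q" by (rule dvdI[of _ _ S]) (simp only: BS)
  then have "nat \<bar>B\<bar> dvd ?p ^ n" unfolding nat_abs_dvd_iff q .
  then obtain k where k: "nat \<bar>B\<bar> = ?p ^ k" using divides_primepow_nat[OF p(2)] by blast
  have "\<bar>B\<bar> = int (nat \<bar>B\<bar>)" by simp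
  then have absB: "\<bar>B\<bar> = int ?p ^ k" by (simp only: k of_nat_power)
  \<comment> \<open>The elements 0 and -1 always lie in \<open>U\<close>; so \<open>A ^ 2\<close>
    exceeds \<open>q\<close> strictly, which supplies the extra factor \<open>p\<close> needed at
    every step of the tower.\<close>
  have "card U \<ge> 2"
  proof -
    have "{0, - 1} \<subseteq> U" using D K.minus_one_power[OF D bijU] by (auto simp: U_def zero_power)
    then have "card {0, - 1 :: 'a} \<le> card U" by (intro card_mono) auto
    then show ?thesis by simp
  qed
  have "?p ^ n < ?p ^ (2 * k)"
  proof -
    have "int (?p ^ (2 * k)) = \<bar>B\<bar> ^ 2"
      by (simp only: absB of_nat_power power_mult[symmetric] mult.commute)
    also have "\<dots> = int (?p ^ n * card U)" by (simp only: power2_abs B2 q)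
    finally have "?p ^ (2 * k) = ?p ^ n * card U" by (simp only: of_nat_eq_iff)
    moreover have "?p ^ n * 1 < ?p ^ n * card U"
      using \<open>card U \<ge> 2\<close> p1 by (intro mult_strict_left_mono) auto
    ultimately show ?thesis by simp
  qed
  then have nk: "n < 2 * k" using p1 power_less_imp_less_exp by blast
  have W_int: "subfield_sum n D a = of_int (B * s a)" for a :: 'a
    by (simp add: s(1) A_eq B_def)
  define t where "t = multiplicity 2 n"
  have step: "additive_power_on D (fixed_field (2 ^ i) :: 'a set)" if "i \<le> t" for i
    using that
  proof (induction i)
    case 0
    show ?case using additive_power_on_prime_field[OF n D bijD W_int] by simp
  next
    case (Suc i)
    have "2 ^ Suc i dvd n"
      using Suc.prems multiplicity_dvd'[of "Suc i" 2 n] by (simp add: t_def)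
    then obtain m where "n = 2 ^ Suc i * m" by (rule dvdE)
    then have m: "n = 2 * 2 ^ i * m" by simp
    \<comment> \<open>Here \<open>2 ^ i * m\<close> is half of \<open>n\<close>, and
      \<open>n < 2 * k\<close>.\<close>
    have "2 ^ i * m + 1 \<le> k" using nk m by simp
    then have "int ?p ^ (2 ^ i * m + 1) dvd int ?p ^ k" by (rule le_imp_power_dvd)
    also have "int ?p ^ k = \<bar>B\<bar>" by (rule absB[symmetric])
    finally have dvd: "int ?p ^ (2 ^ i * m + 1) dvd B" by simp
    have "additive_power_on D (fixed_field (2 * 2 ^ i) :: 'a set)"
    proof (rule additive_power_on_quadratic_extension[OF _ _ _ D bijD E])
      show "fdeg TYPE('a) = 2 * 2 ^ i * m" using n m by simp
      show "m > 0" using n0 m by (cases m) auto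
      show "subfield_sum (2 * 2 ^ i * m) D a = of_int (B * s a)" for a :: 'a
        using W_int[of a] m by simp
    qed (use Suc dvd in auto)
    then show ?case by simp
  qed
  have "fixed_field (2 ^ t) \<subseteq> U"
    using step[of t] by (auto simp: additive_power_on_def U_def)
  then have "card (fixed_field (2 ^ t) :: 'a set) \<le> card U" by (intro card_mono) auto
  moreover have "card (fixed_field (2 ^ t) :: 'a set) = ?p ^ (2 ^ t)"
    by (rule card_fixed_field) (auto simp: t_def multiplicity_dvd simp flip: n)
  ultimately show ?thesis using A2 by (auto simp: t_def)
qed

section \<open>Reduction of the integer exponent and conclusion\<close>

lemma power_int_eq_power:
  fixes x :: "'a::{finite,field}"
  assumes "d mod (int CARD('a) - 1) \<noteq> 0"
  shows "x powi d = x ^ nat (d mod (int CARD('a) - 1))"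
proof (cases "x = 0")
  case True
  \<comment> \<open>At 0 both powers are 0 because neither exponent is; this includes negative
    \<open>d\<close>, where \<open>0 powi d\<close> is 0 by convention.\<close>
  have "d \<noteq> 0" using assms by auto
  moreover have "nat (d mod (int CARD('a) - 1)) \<noteq> 0"
  proof -
    have "CARD('a) > 1" using card_mono[of UNIV "{0, 1 :: 'a}"] by simp
    then have "0 \<le> d mod (int CARD('a) - 1)" by simp
    then show ?thesis using assms by linarith
  qed
  ultimately show ?thesis using True by (simp add: power_int_0_left_if)
next
  case False
  let ?N = "int CARD('a) - 1"
  have q1: "CARD('a) > 1" using card_mono[of UNIV "{0, 1 :: 'a}"] by simp
  then have N: "?N = int (CARD('a) - 1)" by simp
  have "x powi d = x powi (?N * (d div ?N) + d mod ?N)" by simp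
  also have "\<dots> = (x powi ?N) powi (d div ?N) * x powi (d mod ?N)"
    using False by (simp only: power_int_add power_int_mult simp_thms)
  also have "x powi ?N = 1" unfolding N using power_card_minus_one[OF False] by (simp only: power_int_of_nat)
  finally have "x powi d = x powi (d mod ?N)" by simp
  moreover have "d mod ?N = int (nat (d mod ?N))" using q1 by simp
  ultimately show ?thesis by (metis power_int_of_nat)
qed

theorem theorem1p7:
  fixes d :: int and A :: complex
  assumes "gcd d (int CARD('a::{finite,field}) - 1) = 1"
    and "card ((weil_sum d :: 'a \<Rightarrow> complex) ` (UNIV - {0})) = 3"
    and "(weil_sum d :: 'a \<Rightarrow> complex) ` (UNIV - {0}) = {0, A, -A}"
  shows "cmod A \<ge> real CHAR('a) powr (2 powr (real (multiplicity 2 (fdeg TYPE('a))) - 1))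
                   * sqrt (real CARD('a))"
proof -
  let ?q = "CARD('a)" and ?p = "CHAR('a)"
  define n where "n = fdeg TYPE('a)"
  define D where "D = nat (d mod (int ?q - 1))"
  \<comment> \<open>Three values need three nonzero arguments, so \<open>q - 1\<close> is at least
    3. It therefore cannot divide \<open>d\<close>, which is coprime to it, and the reduced exponent
    \<open>D\<close> is positive.\<close>
  have "3 \<le> card (UNIV - {0 :: 'a})" using card_image_le[of "UNIV - {0 :: 'a}" "weil_sum d"] assms(2) by simp
  then have q: "?q \<ge> 4" by (simp add: card_Diff_singleton)
  have mod0: "d mod (int ?q - 1) \<noteq> 0"
  proof
    assume "d mod (int ?q - 1) = 0"
    then have "int ?q - 1 dvd gcd d (int ?q - 1)" by (simp add: dvd_eq_mod_eq_0)
    then show False using assms(1) q by simp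
  qed
  have intD: "int D = d mod (int ?q - 1)" using q by (simp add: D_def)
  have D: "D > 0" using mod0 intD by (cases D) auto
  have pow: "x powi d = x ^ D" for x :: 'a unfolding D_def by (rule power_int_eq_power[OF mod0])
  have "coprime D (?q - 1)"
  proof -
    have "gcd (int D) (int (?q - 1)) = 1"
      using assms(1) q by (simp add: intD gcd_red_int[symmetric] gcd.commute of_nat_diff)
    then have "int (gcd D (?q - 1)) = 1" by (simp only: gcd_int_int_eq)
    then show ?thesis by (simp only: coprime_iff_gcd_eq_1 of_nat_eq_1_iff)
  qed
  \<comment> \<open>The inverse of \<open>D\<close> modulo \<open>q - 1\<close>; raising to it
    undoes the power map, which is therefore a bijection.\<close>
  then obtain E where "[D * E = Suc 0] (mod ?q - 1)" using cong_solve_coprime_nat by blast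
  then have DE: "(D * E) mod (?q - 1) = 1" using q by (simp add: cong_def)
  have E: "(x ^ D) ^ E = x" for x :: 'a
  proof (cases "x = 0")
    case True
    have "D * E \<noteq> 0" using DE by (metis mod_0 zero_neq_one)
    then show ?thesis using True by (simp add: zero_power flip: power_mult)
  next
    case False
    have "(x ^ D) ^ E = x ^ ((?q - 1) * ((D * E) div (?q - 1)) + 1)"
      by (metis DE mult_div_mod_eq power_mult)
    then show ?thesis
      by (simp only: power_add power_mult power_card_minus_one[OF False] power_one power_one_right mult_1_left)
  qed
  have "inj (\<lambda>x :: 'a. x ^ D)" by (rule inj_on_inverseI[of _ "\<lambda>x. x ^ E"]) (rule E)
  then have bijD: "bij (\<lambda>x :: 'a. x ^ D)" by (simp add: bij_def finite_UNIV_inj_surj)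
  have weil: "weil_sum d a = subfield_sum n D a" for a :: 'a
    by (simp add: weil_sum_def subfield_sum_def n_def fixed_field_fdeg psi_eq_trace_char pow)
  have "subfield_sum n D a \<in> {0, A, - A}" if "a \<noteq> 0" for a :: 'a
    using assms(3) that weil by (metis DiffI UNIV_I image_eqI singletonD)
  then obtain u where u: "u \<ge> ?p ^ (2 ^ multiplicity 2 n)" "A ^ 2 = of_nat (?q * u)"
    using three_valued_bound[OF n_def D bijD E] by blast
  have p0: "?p > 0" using prime_gt_0_nat[OF prime_CHAR_finite] .
  let ?s = "multiplicity 2 n"
  \<comment> \<open>The bound is compared after squaring, which doubles the exponent
    \<open>2 powr (s - 1)\<close> to \<open>2 ^ s\<close>.\<close>
  have "(real ?p powr (2 powr (real ?s - 1)) * sqrt (real ?q)) ^ 2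
      = real ?p powr (2 * 2 powr (real ?s - 1)) * real ?q"
  proof -
    have "(x powr y) ^ 2 = x powr (2 * y)" for x y :: real
      by (simp add: power2_eq_square flip: powr_add)
    then show ?thesis by (simp add: power_mult_distrib)
  qed
  also have "2 * 2 powr (real ?s - 1) = 2 powr real ?s"
    by (simp add: powr_diff)
  also have "\<dots> = real (2 ^ ?s)" by (simp add: powr_realpow)
  also have "real ?p powr real (2 ^ ?s) = real (?p ^ (2 ^ ?s))"
    by (rule trans[OF powr_realpow]) (use p0 in simp_all)
  also have "real (?p ^ (2 ^ ?s)) * real ?q \<le> real u * real ?q"
    using u(1) by (intro mult_right_mono) (simp_all only: of_nat_le_iff of_nat_0_le_iff)
  also have "\<dots> = cmod A ^ 2"
  proof -
    have "cmod (A ^ 2) = real (?q * u)" unfolding u(2) by (rule norm_of_nat)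
    then show ?thesis by (simp add: norm_power mult.commute)
  qed
  finally show ?thesis unfolding n_def by (rule power2_le_imp_le) simp
qed

end
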